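(* Let $d\ge2$ be an integer and let $\gamma>0$, $c_0>0$ be real numbers with $c_0>\gamma^d$. Let $\delta$ satisfy $\gamma c_0^{-1/d}<\delta<1$. Then $$\mathfrak{m}_d(\delta)\;\ge\;\kappa_d^{-1}\int_{\mathcal{N}_d^*[\delta]}\widetilde J_d(\boldsymbol\beta',\mathbf{u})\cdot\widetilde\Gamma_d(\boldsymbol\beta',\mathbf{u})\,\mathrm{d}\lambda_{p+d-1}(\boldsymbol\beta',\mathbf{u}),$$ where $$\mathcal{N}_d^*[\delta]:=\{(\boldsymbol\beta',\mathbf{u})\in\mathcal{N}_d^*:\boldsymbol\beta'\in\Delta_{d-1}(\delta)\},$$ $$\Delta_{d-1}(\delta):=\left\{\boldsymbol\beta'\in(\mathbb{R}_{>0})^{d-1}:\ \beta_i'>\sqrt\delta\ \text{ for all }1\le i\le d-1,\ \text{ and }\ \prod_{i=1}^{d-1}\beta_i'<\frac1{\sqrt\delta}\right\},$$ and $\kappa_d:=\int_{\widetilde{\mathcal{M}}_d}\mathrm{d}\,\mathrm{vol}_{p'}(H)$ is the area of the hypersurface $\widetilde{\mathcal{M}}_d$.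
   Context: Put $p:=d(d-1)/2$ and $p':=d(d+1)/2-1=p+d-1$; $\lambda_k$ is $k$-dimensional Lebesgue measure. $\mathcal{T}_d^+$ is the set of upper triangular real $d\times d$ matrices with non-negative diagonal entries, viewed as a subset of $\mathbb{R}^{p'+1}$ via the entries $(t_{ij})_{1\le i\le j\le d}$. For $T\in\mathcal{T}_d^+$ set $f(T):=c_0^{-1/d}(\gamma I_d+{}^tT\,T)$ and $g:=\det\circ f$; write $\partial_{ij}=\partial/\partial t_{ij}$ and $\nabla g=(\partial_{ij}g)_{1\le i\le j\le d}$. Let $$\widetilde{\mathcal{M}}_d:=\{T\in\mathcal{T}_d^+:\det(\gamma I_d+{}^tT\,T)=c_0\}=g^{-1}(\{1\}),\qquad\mathcal{M}_d^*:=\{T\in\widetilde{\mathcal{M}}_d:\mathrm{rank}(T)=d\}.$$ $\widetilde{\mathcal{M}}_d$ is a compact hypersurface; $\mathrm{vol}_{p'}$ is the $p'$-dimensional volume measure induced on it by the Euclidean structure of $\mathbb{R}^{p'+1}$, and $\widetilde\nu_d$ is the probability measure $\widetilde\nu_d(\mathcal{B}):=\mathrm{vol}_{p'}(\mathcal{B})/\mathrm{vol}_{p'}(\widetilde{\mathcal{M}}_d)$. For a positive definite symmetric matrix $Q$, $M_d(Q):=\min_{\mathbf{a}\in\mathbb{Z}^d\setminus\{\mathbf{0}\}}{}^t\mathbf{a}\,Q\,\mathbf{a}$. Define $$\mathfrak{m}_d(\delta):=\widetilde\nu_d\left(\left\{H\in\mathcal{M}_d^*:M_d\left(c_0^{-1/d}(\gamma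 I_d+{}^tH\,H)\right)>\delta\right\}\right).$$ $\Sigma_d^{++}$ is the set of real symmetric positive definite $d\times d$ matrices of determinant $1$. $\Theta_d^{++}$ is the set of upper triangular $d\times d$ matrices with strictly positive diagonal and determinant $1$, whose elements $L$ are written $(\boldsymbol\beta',\mathbf{u})\in(\mathbb{R}_{>0})^{d-1}\times\mathbb{R}^p$, with $\boldsymbol\beta'$ the first $d-1$ diagonal entries and $\mathbf{u}$ the strictly upper triangular entries. $\widetilde\varphi_{chol}:\Theta_d^{++}\to\Sigma_d^{++}$, $L\mapsto{}^tL\,L$, is a bijection (Cholesky decomposition). Set $\mathcal{N}_d^*:=(\widetilde\varphi_{chol}^{-1}\circ f)(\mathcal{M}_d^* )\subset\Theta_d^{++}$. For $L=(l_{ij})\in\mathcal{N}_d^*$, let $H=(h_{ij})\in\mathcal{M}_d^*$ be the unique matrix such that ${}^tL\,L=c_0^{-1/d}(\gamma I_d+{}^tH\,H)$, and define $$\widetilde J_d(L):=c_0^{(d-1)(d+2)/(2d)}\prod_{i=1}^{d-1}\left(\frac{l_{ii}}{h_{ii}}\right)^{d-i+1},\qquad\widetilde\Gamma_d(L):=\frac{\|\nabla g(H)\|_2}{|\partial_{dd}g(H)|},$$ also written $\widetilde J_d(\boldsymbol\beta',\mathbf{u})$ and $\widetilde\Gamma_d(\boldsymbol\beta',\mathbf{u})$ when $L=(\boldsymbol\beta',\mathbf{u})$. *)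

theory Defs
  imports
    "HOL-Analysis.Lebesgue_Measure"
    "HOL-Analysis.Set_Integral"
    "HOL-Analysis.Function_Topology"
    "Jordan_Normal_Form.DL_Rank"
begin

section \<open>Volume measure induced on a submanifold of a coordinate space\<close>

text \<open>
  For a finite index set \<open>K\<close>, the Euclidean space of dimension \<open>card K\<close> is the set
  \<open>K \<rightarrow>\<^sub>E UNIV\<close> of real-valued families indexed by \<open>K\<close>; its Lebesgue measure is
  the product of \<open>lborel\<close> over \<open>K\<close>, and its topology is the subspace topology of the
  product topology on functions.
\<close>

definition leb :: "'i set \<Rightarrow> ('i \<Rightarrow> real) measure" where
  "leb K = (\<Pi>\<^sub>M i\<in>K. lborel)"

definition partial :: "'i \<Rightarrow> (('i \<Rightarrow> real) \<Rightarrow> real) \<Rightarrow> ('i \<Rightarrow> real) \<Rightarrow> real" where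
  "partial a F x = deriv (\<lambda>s. F (x(a := s))) (x a)"

definition gram_entry ::
  "'j set \<Rightarrow> (('i \<Rightarrow> real) \<Rightarrow> 'j \<Rightarrow> real) \<Rightarrow> ('i \<Rightarrow> real) \<Rightarrow> 'i \<Rightarrow> 'i \<Rightarrow> real" where
  "gram_entry J \<phi> x a b = (\<Sum>j\<in>J. partial a (\<lambda>y. \<phi> y j) x * partial b (\<lambda>y. \<phi> y j) x)"

text \<open>The determinant of the Gram matrix, whose rows and columns are indexed by \<open>K\<close>,
  written out by the Leibniz formula.\<close>

definition gram_det ::
  "'i set \<Rightarrow> 'j set \<Rightarrow> (('i \<Rightarrow> real) \<Rightarrow> 'j \<Rightarrow> real) \<Rightarrow> ('i \<Rightarrow> real) \<Rightarrow> real" where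
  "gram_det K J \<phi> x =
     (\<Sum>\<pi> | \<pi> permutes K. of_int (sign \<pi>) * (\<Prod>a\<in>K. gram_entry J \<phi> x a (\<pi> a)))"

text \<open>Injective \<open>C\<^sup>1\<close> immersions from an open subset of the space indexed by \<open>K\<close> into the
  subset \<open>M\<close> of the space indexed by \<open>J\<close>.\<close>

definition local_param ::
  "'i set \<Rightarrow> 'j set \<Rightarrow> ('j \<Rightarrow> real) set \<Rightarrow> ('i \<Rightarrow> real) set \<Rightarrow> (('i \<Rightarrow> real) \<Rightarrow> 'j \<Rightarrow> real) \<Rightarrow> bool" where
  "local_param K J M U \<phi> \<longleftrightarrow>
     openin (top_of_set (K \<rightarrow>\<^sub>E UNIV)) U \<and> \<phi> ` U \<subseteq> M \<and> inj_on \<phi> U \<and> continuous_on U \<phi> \<and>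
     (\<forall>a\<in>K. \<forall>j\<in>J.
        (\<forall>x\<in>U. (\<lambda>s. \<phi> (x(a := s)) j) differentiable at (x a)) \<and>
        continuous_on U (partial a (\<lambda>y. \<phi> y j))) \<and>
     (\<forall>x\<in>U. gram_det K J \<phi> x \<noteq> 0)"

text \<open>
  The volume of \<open>\<phi> ` A\<close> for a local parametrization \<open>\<phi>\<close> is the integral over \<open>A\<close> of the
  square root of the Gram determinant. The volume of \<open>B \<subseteq> M\<close> is the supremum of the total
  volumes of countable disjoint families of parametrized pieces of \<open>B\<close>. If \<open>M\<close> is a \<open>C\<^sup>1\<close>
  submanifold, the change of variables formula makes the volume of a piece independent of
  its parametrization, so the supremum is attained by every partition of \<open>B\<close> into
  parametrized pieces. If \<open>M\<close> has a boundary, only its interior is parametrized, and the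
  boundary is a null set. Only the cardinality of \<open>K\<close>, which is the dimension of
  the submanifold, matters.
\<close>

definition pieces ::
  "'i set \<Rightarrow> 'j set \<Rightarrow> ('j \<Rightarrow> real) set \<Rightarrow> ('j \<Rightarrow> real) set \<Rightarrow>
   (nat \<Rightarrow> ('i \<Rightarrow> real) set \<times> (('i \<Rightarrow> real) \<Rightarrow> 'j \<Rightarrow> real) \<times> ('i \<Rightarrow> real) set) set" where
  "pieces K J M B = {P.
     (\<forall>n. case P n of (U, \<phi>, A) \<Rightarrow>
        local_param K J M U \<phi> \<and> A \<in> sets (leb K) \<and> A \<subseteq> U \<and> \<phi> ` A \<subseteq> B) \<and>
     disjoint_family (\<lambda>n. case P n of (U, \<phi>, A) \<Rightarrow> \<phi> ` A)}"

definition piece_volume ::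
  "'i set \<Rightarrow> 'j set \<Rightarrow> ('i \<Rightarrow> real) set \<times> (('i \<Rightarrow> real) \<Rightarrow> 'j \<Rightarrow> real) \<times> ('i \<Rightarrow> real) set \<Rightarrow> ennreal" where
  "piece_volume K J = (\<lambda>(U, \<phi>, A). \<integral>\<^sup>+x\<in>A. ennreal (sqrt (gram_det K J \<phi> x)) \<partial>leb K)"

definition volume_fun ::
  "'i set \<Rightarrow> 'j set \<Rightarrow> ('j \<Rightarrow> real) set \<Rightarrow> ('j \<Rightarrow> real) set \<Rightarrow> ennreal" where
  "volume_fun K J M B = (SUP P\<in>pieces K J M B. \<Sum>n. piece_volume K J (P n))"

definition induced_volume ::
  "'i set \<Rightarrow> 'j set \<Rightarrow> ('j \<Rightarrow> real) set \<Rightarrow> ('j \<Rightarrow> real) measure" where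
  "induced_volume K J M =
     measure_of (space (restrict_space (leb J) M)) (sets (restrict_space (leb J) M))
       (volume_fun K J M)"

lemma sets_induced_volume: "sets (induced_volume K J M) = sets (restrict_space (leb J) M)"
  unfolding induced_volume_def by (simp add: sets.sigma_sets_eq)

lemma space_induced_volume: "space (induced_volume K J M) = M \<inter> (J \<rightarrow>\<^sub>E UNIV)"
  by (rule trans[OF sets_eq_imp_space_eq[OF sets_induced_volume]])
     (simp add: leb_def space_restrict_space space_PiM)

subsection \<open>The induced volume is a measure\<close>

lemma openin_sets_leb:
  assumes "openin (top_of_set (K \<rightarrow>\<^sub>E UNIV)) U"
  shows "U \<in> sets (leb (K :: 'i :: countable set))"
proof -
  obtain V where V: "open V" "U = (K \<rightarrow>\<^sub>E UNIV) \<inter> V"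
    using assms by (auto simp: openin_open)
  have "(\<lambda>x. x) \<in> leb K \<rightarrow>\<^sub>M (\<Pi>\<^sub>M i\<in>UNIV. borel)"
  proof (rule measurable_PiM_single')
    fix i :: 'i
    show "(\<lambda>x. x i) \<in> borel_measurable (leb K)"
    proof (cases "i \<in> K")
      case True
      then have "(\<lambda>x. x i) \<in> leb K \<rightarrow>\<^sub>M lborel"
        unfolding leb_def by (rule measurable_component_singleton)
      then show ?thesis by simp
    next
      case False
      have undef: "x i = undefined" if "x \<in> space (leb K)" for x
        using that False unfolding leb_def space_PiM by (rule PiE_arb)
      have "(\<lambda>x. x i) \<in> borel_measurable (leb K) \<longleftrightarrow>
          (\<lambda>x. undefined :: real) \<in> borel_measurable (leb K)"
        by (rule measurable_cong) (rule undef)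
      then show ?thesis by simp
    qed
  qed auto
  moreover have "V \<in> sets (\<Pi>\<^sub>M i\<in>UNIV. borel :: real measure)"
    using V by (simp add: sets_PiM_equal_borel)
  ultimately have "(\<lambda>x. x) -` V \<inter> space (leb K) \<in> sets (leb K)"
    by (rule measurable_sets)
  moreover have "space (leb K) = K \<rightarrow>\<^sub>E UNIV"
    by (simp add: leb_def space_PiM)
  ultimately show ?thesis using V by (simp add: Int_commute)
qed

lemma continuous_on_measurable_leb:
  fixes f :: "('i :: countable \<Rightarrow> real) \<Rightarrow> real"
  assumes "openin (top_of_set (K \<rightarrow>\<^sub>E UNIV)) U" "continuous_on U f"
  shows "f \<in> borel_measurable (restrict_space (leb K) U)"
proof (rule borel_measurableI)
  fix S :: "real set"
  assume "open S"
  then obtain W where W: "open W" "W \<inter> U = f -` S \<inter> U"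
    using assms(2) by (auto simp: continuous_on_open_invariant)
  have "openin (top_of_set (K \<rightarrow>\<^sub>E UNIV)) (U \<inter> W)"
    using assms(1) W by (simp add: openin_Int_open)
  then have *: "U \<inter> W \<in> sets (leb K)" "U \<in> sets (leb K)"
    using openin_sets_leb assms by blast+
  then have "U \<subseteq> space (leb K)" using sets.sets_into_space by blast
  then have "f -` S \<inter> space (restrict_space (leb K) U) = U \<inter> (U \<inter> W)"
    using W by (auto simp: space_restrict_space)
  then show "f -` S \<inter> space (restrict_space (leb K) U) \<in> sets (restrict_space (leb K) U)"
    using * by (auto simp: sets_restrict_space)
qed

lemma local_param_measurable:
  fixes K :: "'i :: countable set"
  assumes "local_param K J M U \<phi>" "M \<subseteq> J \<rightarrow>\<^sub>E UNIV"
  shows "\<phi> \<in> restrict_space (leb K) U \<rightarrow>\<^sub>M leb J"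
  unfolding leb_def[of J]
proof (rule measurable_PiM_single')
  fix j assume "j \<in> J"
  have "continuous_on U (\<lambda>x. \<phi> x j)"
    using assms by (auto simp: local_param_def intro: continuous_on_product_then_coordinatewise)
  then show "(\<lambda>x. \<phi> x j) \<in> restrict_space (leb K) U \<rightarrow>\<^sub>M lborel"
    using continuous_on_measurable_leb assms(1) by (auto simp: local_param_def)
next
  show "\<phi> \<in> space (restrict_space (leb K) U) \<rightarrow> J \<rightarrow>\<^sub>E space lborel"
    using assms by (auto simp: local_param_def space_restrict_space)
qed

lemma gram_det_measurable:
  fixes K :: "'i :: countable set"
  assumes "local_param K J M U \<phi>"
  shows "gram_det K J \<phi> \<in> borel_measurable (restrict_space (leb K) U)"
proof -
  have "continuous_on U (gram_det K J \<phi>)"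
    unfolding gram_det_def[abs_def] gram_entry_def
  proof (intro continuous_on_sum continuous_on_mult continuous_on_const continuous_on_prod)
    fix \<pi> a j assume "\<pi> \<in> {\<pi>. \<pi> permutes K}" "a \<in> K" "j \<in> J"
    then have "\<pi> a \<in> K" by (auto simp: permutes_in_image)
    then show "continuous_on U (partial a (\<lambda>y. \<phi> y j))"
      "continuous_on U (partial (\<pi> a) (\<lambda>y. \<phi> y j))"
      using assms \<open>a \<in> K\<close> \<open>j \<in> J\<close> by (auto simp: local_param_def)
  qed
  then show ?thesis
    using continuous_on_measurable_leb assms by (auto simp: local_param_def)
qed

lemma volume_fun_empty: "volume_fun K J M {} = 0"
proof -
  have "piece_volume K J (P n) = 0" if "P \<in> pieces K J M {}" for P n
    using that by (auto simp: pieces_def piece_volume_def split: prod.splits dest!: spec[of _ n])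
  then have "volume_fun K J M {} \<le> 0"
    unfolding volume_fun_def by (intro SUP_least) simp
  then show ?thesis by simp
qed

lemma volume_fun_mono: "B \<subseteq> C \<Longrightarrow> volume_fun K J M B \<le> volume_fun K J M C"
  unfolding volume_fun_def
  by (rule SUP_subset_mono) (auto simp: pieces_def split: prod.splits, blast+)

lemma pieces_nonempty: "pieces K J M B \<noteq> {}"
proof -
  have "(\<lambda>n. ({}, \<lambda>x. undefined, {})) \<in> pieces K J M B"
    by (auto simp: pieces_def local_param_def disjoint_family_on_def)
  then show ?thesis by blast
qed

lemma suminf_interleave:
  fixes h :: "nat \<Rightarrow> ennreal"
  shows "(\<Sum>n. h (2 * n)) + (\<Sum>n. h (2 * n + 1)) \<le> suminf h"
proof -
  have "(\<Sum>n<m. h (2 * n) + h (2 * n + 1)) = (\<Sum>n<2 * m. h n)" for m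
    by (induction m) (simp_all add: add.assoc)
  then have "(\<Sum>n. h (2 * n) + h (2 * n + 1)) \<le> suminf h"
    by (intro suminf_le_const summableI) (auto intro: sum_le_suminf summableI)
  then show ?thesis by (simp add: suminf_add summableI)
qed

lemma volume_fun_superadditive2:
  fixes B :: "('b \<Rightarrow> real) set" and K :: "'i set"
  assumes "B \<inter> C = {}"
  shows "volume_fun K J M B + volume_fun K J M C \<le> volume_fun K J M (B \<union> C)"
proof -
  have main: "(\<Sum>n. piece_volume K J (P n)) + (\<Sum>n. piece_volume K J (Q n)) \<le> volume_fun K J M (B \<union> C)"
    if P: "P \<in> pieces K J M B" and Q: "Q \<in> pieces K J M C" for P Q
  proof -
    define R where "R n = (if even n then P (n div 2) else Q (n div 2))" for n
    define im :: "('i \<Rightarrow> real) set \<times> (('i \<Rightarrow> real) \<Rightarrow> 'b \<Rightarrow> real) \<times> ('i \<Rightarrow> real) set \<Rightarrow> ('b \<Rightarrow> real) set"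
      where "im = (\<lambda>(U, \<phi>, A). \<phi> ` A)"
    have im: "(\<lambda>n. case X n of (U, \<phi>, A) \<Rightarrow> \<phi> ` A) = (\<lambda>n. im (X n))" for X
      by (auto simp: im_def split: prod.splits)
    have imP: "im (P n) \<subseteq> B" "im (Q n) \<subseteq> C" for n
      using P Q by (auto simp: pieces_def im_def split: prod.splits dest!: spec[of _ n])
    have "disjoint_family (\<lambda>n. im (R n))"
      unfolding disjoint_family_on_def
    proof (intro ballI impI)
      fix m n :: nat assume "m \<noteq> n"
      have dP: "im (P k) \<inter> im (P l) = {}" if "k \<noteq> l" for k l
        using that P by (auto simp: pieces_def im disjoint_family_on_def)
      have dQ: "im (Q k) \<inter> im (Q l) = {}" if "k \<noteq> l" for k l
        using that Q by (auto simp: pieces_def im disjoint_family_on_def)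
      have "m div 2 \<noteq> n div 2" if "even m \<longleftrightarrow> even n"
        using that \<open>m \<noteq> n\<close> by presburger
      then show "im (R m) \<inter> im (R n) = {}"
        using dP[of "m div 2" "n div 2"] dQ[of "m div 2" "n div 2"]
          imP[of "m div 2"] imP[of "n div 2"] assms
        unfolding R_def by (auto split: if_splits)
    qed
    moreover have "case R n of (U, \<phi>, A) \<Rightarrow>
        local_param K J M U \<phi> \<and> A \<in> sets (leb K) \<and> A \<subseteq> U \<and> \<phi> ` A \<subseteq> B \<union> C" for n
    proof (cases "even n")
      case True
      have "case P (n div 2) of (U, \<phi>, A) \<Rightarrow>
          local_param K J M U \<phi> \<and> A \<in> sets (leb K) \<and> A \<subseteq> U \<and> \<phi> ` A \<subseteq> B"
        using P by (simp add: pieces_def)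
      then show ?thesis using True by (auto simp: R_def split: prod.splits)
    next
      case False
      have "case Q (n div 2) of (U, \<phi>, A) \<Rightarrow>
          local_param K J M U \<phi> \<and> A \<in> sets (leb K) \<and> A \<subseteq> U \<and> \<phi> ` A \<subseteq> C"
        using Q by (simp add: pieces_def)
      then show ?thesis using False by (auto simp: R_def split: prod.splits)
    qed
    ultimately have "R \<in> pieces K J M (B \<union> C)"
      by (simp add: pieces_def im)
    then have "(\<Sum>n. piece_volume K J (R n)) \<le> volume_fun K J M (B \<union> C)"
      unfolding volume_fun_def by (rule SUP_upper)
    moreover have "(\<Sum>n. piece_volume K J (R (2 * n))) + (\<Sum>n. piece_volume K J (R (2 * n + 1)))
        \<le> (\<Sum>n. piece_volume K J (R n))"
      by (rule suminf_interleave)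
    ultimately show ?thesis by (simp add: R_def)
  qed
  have "volume_fun K J M B + volume_fun K J M C =
      (SUP P\<in>pieces K J M B. SUP Q\<in>pieces K J M C.
        (\<Sum>n. piece_volume K J (P n)) + (\<Sum>n. piece_volume K J (Q n)))"
    unfolding volume_fun_def
    by (subst ennreal_SUP_add_left[OF pieces_nonempty, symmetric])
       (simp only: ennreal_SUP_add_right[OF pieces_nonempty])
  also have "\<dots> \<le> volume_fun K J M (B \<union> C)"
    by (intro SUP_least main)
  finally show ?thesis .
qed

lemma volume_fun_superadditive:
  fixes B :: "nat \<Rightarrow> ('b \<Rightarrow> real) set"
  assumes "disjoint_family B"
  shows "(\<Sum>j. volume_fun K J M (B j)) \<le> volume_fun K J M (\<Union>j. B j)"
proof (intro suminf_le_const summableI)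
  fix n
  have "(\<Sum>j<n. volume_fun K J M (B j)) \<le> volume_fun K J M (\<Union>j<n. B j)"
  proof (induction n)
    case 0
    then show ?case by simp
  next
    case (Suc n)
    have "(\<Union>j<n. B j) \<inter> B n = {}"
    proof -
      have "B j \<inter> B n = {}" if "j < n" for j
        using disjoint_family_onD[OF assms, of j n] that by simp
      then show ?thesis by blast
    qed
    from volume_fun_superadditive2[OF this, of K J M] Suc
    have "(\<Sum>j<n. volume_fun K J M (B j)) + volume_fun K J M (B n)
        \<le> volume_fun K J M ((\<Union>j<n. B j) \<union> B n)"
      by (meson add_right_mono order_trans)
    moreover have "(\<Union>j<n. B j) \<union> B n = (\<Union>j<Suc n. B j)"
      by (auto simp: lessThan_Suc)
    ultimately show ?case by simp
  qed
  also have "\<dots> \<le> volume_fun K J M (\<Union>j. B j)"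
    by (rule volume_fun_mono) auto
  finally show "(\<Sum>j<n. volume_fun K J M (B j)) \<le> volume_fun K J M (\<Union>j. B j)" .
qed

lemma volume_fun_subadditive:
  fixes K :: "'i :: countable set" and B :: "nat \<Rightarrow> ('b \<Rightarrow> real) set"
  assumes "disjoint_family B" "M \<subseteq> J \<rightarrow>\<^sub>E UNIV" "\<And>j. B j \<in> sets (restrict_space (leb J) M)"
  shows "volume_fun K J M (\<Union>j. B j) \<le> (\<Sum>j. volume_fun K J M (B j))"
  unfolding volume_fun_def[of _ _ _ "\<Union>j. B j"]
proof (rule SUP_least)
  fix P assume P: "P \<in> pieces K J M (\<Union>j. B j)"
  define Q where "Q j n = (case P n of (U, \<phi>, A) \<Rightarrow> (U, \<phi>, A \<inter> \<phi> -` B j))" for j n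
  have P': "local_param K J M U \<phi>" "A \<in> sets (leb K)" "A \<subseteq> U" "\<phi> ` A \<subseteq> (\<Union>j. B j)"
    if "P n = (U, \<phi>, A)" for n U \<phi> A
    using P that by (auto simp: pieces_def dest!: spec[of _ n])
  have meas: "A \<inter> \<phi> -` B j \<in> sets (leb K)" if "P n = (U, \<phi>, A)" for n U \<phi> A j
  proof -
    have U: "U \<in> sets (leb K)"
      using P'(1)[OF that] openin_sets_leb by (auto simp: local_param_def)
    obtain C where C: "C \<in> sets (leb J)" "B j = M \<inter> C"
      using assms(3)[of j] by (auto simp: sets_restrict_space)
    have "\<phi> -` C \<inter> space (restrict_space (leb K) U) \<in> sets (restrict_space (leb K) U)"
      using local_param_measurable[OF P'(1)[OF that] assms(2)] C(1) by (rule measurable_sets)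
    then have "\<phi> -` C \<inter> space (restrict_space (leb K) U) \<in> sets (leb K)"
      using U by (auto simp: sets_restrict_space)
    then have "A \<inter> (\<phi> -` C \<inter> space (restrict_space (leb K) U)) \<in> sets (leb K)"
      using P'(2)[OF that] by auto
    moreover have "A \<inter> (\<phi> -` C \<inter> space (restrict_space (leb K) U)) = A \<inter> \<phi> -` B j"
      using P'[OF that] C sets.sets_into_space[OF U]
      by (auto simp: space_restrict_space local_param_def)
    ultimately show ?thesis by simp
  qed
  have Q: "Q j \<in> pieces K J M (B j)" for j
  proof -
    have "disjoint_family (\<lambda>n. case P n of (U, \<phi>, A) \<Rightarrow> \<phi> ` A)"
      using P by (simp add: pieces_def)
    moreover have "(case Q j n of (U, \<phi>, A) \<Rightarrow> \<phi> ` A) \<subseteq> (case P n of (U, \<phi>, A) \<Rightarrow> \<phi> ` A)" for n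
      by (auto simp: Q_def split: prod.splits)
    ultimately have "disjoint_family (\<lambda>n. case Q j n of (U, \<phi>, A) \<Rightarrow> \<phi> ` A)"
      by (rule disjoint_family_subset)
    moreover have "case Q j n of (U, \<phi>, A) \<Rightarrow>
        local_param K J M U \<phi> \<and> A \<in> sets (leb K) \<and> A \<subseteq> U \<and> \<phi> ` A \<subseteq> B j" for n
      using P'[of n] meas[of n] by (cases "P n") (auto simp: Q_def)
    ultimately show ?thesis by (simp add: pieces_def)
  qed
  have split: "piece_volume K J (P n) = (\<Sum>j. piece_volume K J (Q j n))" for n
  proof -
    obtain U \<phi> A where PA: "P n = (U, \<phi>, A)" by (cases "P n")
    note p = P'[OF PA]
    define F where "F x = ennreal (sqrt (gram_det K J \<phi> x))" for x
    have U: "U \<in> sets (leb K)"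
      using p(1) openin_sets_leb by (auto simp: local_param_def)
    have "F \<in> borel_measurable (restrict_space (leb K) U)"
      using gram_det_measurable[OF p(1)] unfolding F_def by measurable
    then have FU: "(\<lambda>x. F x * indicator U x) \<in> borel_measurable (leb K)"
      using U by (subst (asm) borel_measurable_restrict_space_iff_ennreal)
        (auto simp: sets.Int_space_eq2 mult.commute)
    have eq: "F x * indicator (A \<inter> \<phi> -` B j) x
        = F x * indicator U x * indicator (A \<inter> \<phi> -` B j) x" for j x
      using p by (auto simp: indicator_def)
    have Fj: "(\<lambda>x. F x * indicator (A \<inter> \<phi> -` B j) x) \<in> borel_measurable (leb K)" for j
      unfolding eq using FU meas[OF PA] by measurable
    have "F x * indicator A x = (\<Sum>j. F x * indicator (A \<inter> \<phi> -` B j) x)" for x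
    proof -
      have "disjoint_family (\<lambda>j. A \<inter> \<phi> -` B j)"
        using assms(1) by (auto simp: disjoint_family_on_def)
      moreover have "A = (\<Union>j. A \<inter> \<phi> -` B j)"
        using p(4) by blast
      ultimately have "indicator A x = (\<Sum>j. indicator (A \<inter> \<phi> -` B j) x :: ennreal)"
        using suminf_indicator by metis
      then show ?thesis by (simp add: ennreal_suminf_cmult)
    qed
    then have "piece_volume K J (P n) = (\<integral>\<^sup>+x. (\<Sum>j. F x * indicator (A \<inter> \<phi> -` B j) x) \<partial>leb K)"
      by (simp add: PA piece_volume_def F_def)
    also have "\<dots> = (\<Sum>j. \<integral>\<^sup>+x. F x * indicator (A \<inter> \<phi> -` B j) x \<partial>leb K)"
      by (rule nn_integral_suminf) (rule Fj)
    also have "\<dots> = (\<Sum>j. piece_volume K J (Q j n))"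
      by (simp add: PA Q_def piece_volume_def F_def)
    finally show ?thesis .
  qed
  have "(\<Sum>n. piece_volume K J (P n)) = (\<Sum>n. \<Sum>j. piece_volume K J (Q j n))"
    by (simp add: split)
  also have "\<dots> = (\<integral>\<^sup>+n. (\<Sum>j. piece_volume K J (Q j n)) \<partial>count_space UNIV)"
    by (simp add: nn_integral_count_space_nat)
  also have "\<dots> = (\<Sum>j. \<integral>\<^sup>+n. piece_volume K J (Q j n) \<partial>count_space UNIV)"
    by (rule nn_integral_suminf) simp
  also have "\<dots> = (\<Sum>j. \<Sum>n. piece_volume K J (Q j n))"
    by (simp add: nn_integral_count_space_nat)
  also have "\<dots> \<le> (\<Sum>j. volume_fun K J M (B j))"
    by (intro suminf_le summableI) (auto simp: volume_fun_def intro!: SUP_upper Q)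
  finally show "(\<Sum>n. piece_volume K J (P n)) \<le> (\<Sum>j. volume_fun K J M (B j))" .
qed

theorem emeasure_induced_volume:
  fixes K :: "'i :: countable set" and J :: "'b set"
  assumes "M \<subseteq> J \<rightarrow>\<^sub>E UNIV" "B \<in> sets (restrict_space (leb J) M)"
  shows "emeasure (induced_volume K J M) B = volume_fun K J M B"
proof (rule emeasure_measure_of[OF induced_volume_def])
  show "countably_additive (sets (induced_volume K J M)) (volume_fun K J M)"
  proof (rule countably_additiveI)
    fix B :: "nat \<Rightarrow> ('b \<Rightarrow> real) set"
    assume "range B \<subseteq> sets (induced_volume K J M)" "disjoint_family B"
    then show "(\<Sum>j. volume_fun K J M (B j)) = volume_fun K J M (\<Union>j. B j)"
      using assms(1)
      by (intro antisym volume_fun_superadditive volume_fun_subadditive)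
         (auto simp: sets_induced_volume)
  qed
qed (use assms in \<open>auto simp: positive_def volume_fun_empty sets_induced_volume
       dest: sets.sets_into_space\<close>)

section \<open>Triangular matrices\<close>

text \<open>Rows, columns and coordinates are numbered from \<open>0\<close> to \<open>d - 1\<close>.\<close>

definition tri_idx :: "nat \<Rightarrow> (nat \<times> nat) set" where
  "tri_idx d = {(i, j). i \<le> j \<and> j < d}"

definition theta_idx :: "nat \<Rightarrow> (nat \<times> nat) set" where
  "theta_idx d = tri_idx d - {(d - 1, d - 1)}"

lemma finite_tri_idx: "finite (tri_idx d)"
  by (rule finite_subset[of _ "{..<d} \<times> {..<d}"]) (auto simp: tri_idx_def)

lemma card_tri_idx: "card (tri_idx d) = d * (d + 1) div 2"
proof (induction d)
  case 0
  then show ?case by (simp add: tri_idx_def)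
next
  case (Suc d)
  have "tri_idx (Suc d) = tri_idx d \<union> (\<lambda>i. (i, d)) ` {..d}" "tri_idx d \<inter> (\<lambda>i. (i, d)) ` {..d} = {}"
    by (auto simp: tri_idx_def)
  then have "card (tri_idx (Suc d)) = card (tri_idx d) + Suc d"
    by (simp add: card_Un_disjoint finite_tri_idx card_image inj_on_def)
  then show ?case by (simp add: Suc.IH)
qed

lemma card_theta_idx: "d \<ge> 1 \<Longrightarrow> card (theta_idx d) = d * (d + 1) div 2 - 1"
  unfolding theta_idx_def
  by (subst card_Diff_singleton) (auto simp: card_tri_idx, auto simp: tri_idx_def)

definition tri_mat :: "nat \<Rightarrow> (nat \<times> nat \<Rightarrow> real) \<Rightarrow> real mat" where
  "tri_mat d t = mat d d (\<lambda>(i, j). if i \<le> j then t (i, j) else 0)"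

text \<open>The upper triangular matrices with non-negative diagonal, given by their coordinates.\<close>

definition tri_nonneg :: "nat \<Rightarrow> (nat \<times> nat \<Rightarrow> real) set" where
  "tri_nonneg d = {t \<in> tri_idx d \<rightarrow>\<^sub>E UNIV. \<forall>i<d. t (i, i) \<ge> 0}"

definition Theta_pp :: "nat \<Rightarrow> real mat set" where
  "Theta_pp d = {L \<in> carrier_mat d d.
     upper_triangular L \<and> (\<forall>i<d. L $$ (i, i) > 0) \<and> Determinant.det L = 1}"

definition chol :: "real mat \<Rightarrow> real mat" where
  "chol L = transpose_mat L * L"

text \<open>The element of \<open>Theta_pp d\<close> with coordinates \<open>(\<beta>', u)\<close>: \<open>x (i, i)\<close> is the coordinate
  \<open>\<beta>'\<close> at \<open>i\<close>, and \<open>x (i, j)\<close> with \<open>i < j\<close> is an entry of \<open>u\<close>. The last diagonal entry is forced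
  by the determinant.\<close>

definition theta_mat :: "nat \<Rightarrow> (nat \<times> nat \<Rightarrow> real) \<Rightarrow> real mat" where
  "theta_mat d x =
     tri_mat d (x((d - 1, d - 1) := 1 / (\<Prod>i<d - 1. x (i, i))))"

definition beta_part :: "nat \<Rightarrow> (nat \<times> nat \<Rightarrow> real) \<Rightarrow> nat \<Rightarrow> real" where
  "beta_part d x = (\<lambda>i\<in>{..<d - 1}. x (i, i))"

section \<open>The hypersurface and its normalized volume\<close>

definition shifted_gram :: "nat \<Rightarrow> real \<Rightarrow> real mat \<Rightarrow> real mat" where
  "shifted_gram d \<gamma> T = \<gamma> \<cdot>\<^sub>m 1\<^sub>m d + transpose_mat T * T"

definition f_map :: "nat \<Rightarrow> real \<Rightarrow> real \<Rightarrow> (nat \<times> nat \<Rightarrow> real) \<Rightarrow> real mat" where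
  "f_map d \<gamma> c0 t = c0 powr (- 1 / real d) \<cdot>\<^sub>m shifted_gram d \<gamma> (tri_mat d t)"

definition g_map :: "nat \<Rightarrow> real \<Rightarrow> real \<Rightarrow> (nat \<times> nat \<Rightarrow> real) \<Rightarrow> real" where
  "g_map d \<gamma> c0 t = Determinant.det (f_map d \<gamma> c0 t)"

definition M_tilde :: "nat \<Rightarrow> real \<Rightarrow> real \<Rightarrow> (nat \<times> nat \<Rightarrow> real) set" where
  "M_tilde d \<gamma> c0 =
     {t \<in> tri_nonneg d. Determinant.det (shifted_gram d \<gamma> (tri_mat d t)) = c0}"

definition M_star :: "nat \<Rightarrow> real \<Rightarrow> real \<Rightarrow> (nat \<times> nat \<Rightarrow> real) set" where
  "M_star d \<gamma> c0 = {t \<in> M_tilde d \<gamma> c0. vec_space.rank d (tri_mat d t) = d}"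

definition vol_M :: "nat \<Rightarrow> real \<Rightarrow> real \<Rightarrow> (nat \<times> nat \<Rightarrow> real) measure" where
  "vol_M d \<gamma> c0 = induced_volume (theta_idx d) (tri_idx d) (M_tilde d \<gamma> c0)"

lemma emeasure_vol_M:
  assumes "B \<in> sets (restrict_space (leb (tri_idx d)) (M_tilde d \<gamma> c0))"
  shows "emeasure (vol_M d \<gamma> c0) B = volume_fun (theta_idx d) (tri_idx d) (M_tilde d \<gamma> c0) B"
  unfolding vol_M_def using assms
  by (rule emeasure_induced_volume[rotated]) (auto simp: M_tilde_def tri_nonneg_def)

definition nu_tilde :: "nat \<Rightarrow> real \<Rightarrow> real \<Rightarrow> (nat \<times> nat \<Rightarrow> real) measure" where
  "nu_tilde d \<gamma> c0 = uniform_measure (vol_M d \<gamma> c0) (M_tilde d \<gamma> c0)"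

definition kappa :: "nat \<Rightarrow> real \<Rightarrow> real \<Rightarrow> ennreal" where
  "kappa d \<gamma> c0 = (\<integral>\<^sup>+H\<in>M_tilde d \<gamma> c0. 1 \<partial>vol_M d \<gamma> c0)"

definition lattice_min :: "nat \<Rightarrow> real mat \<Rightarrow> real" where
  "lattice_min d Q = (LEAST m. \<exists>a \<in> carrier_vec d - {0\<^sub>v d}.
     m = scalar_prod (map_vec real_of_int a) (Q *\<^sub>v map_vec real_of_int a))"

definition m_frak :: "nat \<Rightarrow> real \<Rightarrow> real \<Rightarrow> real \<Rightarrow> ennreal" where
  "m_frak d \<gamma> c0 \<delta> =
     emeasure (nu_tilde d \<gamma> c0) {H \<in> M_star d \<gamma> c0. lattice_min d (f_map d \<gamma> c0 H) > \<delta>}"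

section \<open>Cholesky coordinates\<close>

definition N_star :: "nat \<Rightarrow> real \<Rightarrow> real \<Rightarrow> real mat set" where
  "N_star d \<gamma> c0 = (inv_into (Theta_pp d) chol \<circ> f_map d \<gamma> c0) ` M_star d \<gamma> c0"

definition H_of :: "nat \<Rightarrow> real \<Rightarrow> real \<Rightarrow> real mat \<Rightarrow> nat \<times> nat \<Rightarrow> real" where
  "H_of d \<gamma> c0 L = (THE H. H \<in> M_star d \<gamma> c0 \<and> chol L = f_map d \<gamma> c0 H)"

text \<open>With rows numbered from \<open>0\<close>, the exponent \<open>d - i + 1\<close> becomes \<open>d - i\<close>.\<close>

definition J_tilde :: "nat \<Rightarrow> real \<Rightarrow> real \<Rightarrow> real mat \<Rightarrow> real" where
  "J_tilde d \<gamma> c0 L =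
     c0 powr (real ((d - 1) * (d + 2)) / real (2 * d)) *
     (\<Prod>i<d - 1. (L $$ (i, i) / H_of d \<gamma> c0 L (i, i)) ^ (d - i))"

definition Gamma_tilde :: "nat \<Rightarrow> real \<Rightarrow> real \<Rightarrow> real mat \<Rightarrow> real" where
  "Gamma_tilde d \<gamma> c0 L =
     sqrt (\<Sum>ij\<in>tri_idx d. (partial ij (g_map d \<gamma> c0) (H_of d \<gamma> c0 L))\<^sup>2) /
     \<bar>partial (d - 1, d - 1) (g_map d \<gamma> c0) (H_of d \<gamma> c0 L)\<bar>"

definition Delta :: "nat \<Rightarrow> real \<Rightarrow> (nat \<Rightarrow> real) set" where
  "Delta n \<delta> = {\<beta> \<in> {..<n} \<rightarrow>\<^sub>E {0<..}.
     (\<forall>i<n. \<beta> i > sqrt \<delta>) \<and> (\<Prod>i<n. \<beta> i) < 1 / sqrt \<delta>}"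

definition N_star_delta :: "nat \<Rightarrow> real \<Rightarrow> real \<Rightarrow> real \<Rightarrow> (nat \<times> nat \<Rightarrow> real) set" where
  "N_star_delta d \<gamma> c0 \<delta> = {x \<in> theta_idx d \<rightarrow>\<^sub>E UNIV.
     theta_mat d x \<in> N_star d \<gamma> c0 \<and> beta_part d x \<in> Delta (d - 1) \<delta>}"

end

theory Submission
  imports Defs
begin

text \<open>
  Cholesky factorization of \<open>c\<inverse> L\<^sup>T L - \<gamma> I\<close>, where \<open>c = c0 powr (- 1 / d)\<close>, gives a single chart
  \<open>H = chart x\<close> of the part of the hypersurface with positive diagonal, in the coordinates \<open>x\<close> of
  \<open>L\<close>. As the induced volume is a supremum over parametrized pieces, one piece suffices
  for a lower bound.

  Row by row, \<open>h\<^sub>i\<^sub>j\<close> depends only on the entries of \<open>L\<close> up to position \<open>(i, j)\<close> in the lexicographic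
  order, so the Jacobian matrix \<open>P\<close> of the first coordinates of the chart is triangular, with diagonal
  entries \<open>l\<^sub>i\<^sub>i / (c h\<^sub>i\<^sub>i)\<close> and determinant \<open>J_tilde\<close>. The gradient of \<open>g\<close> is orthogonal to the
  derivatives of the chart, so the derivative of the last coordinate is \<open>P v\<close>, where the
  entries of \<open>v\<close> are \<open>- \<partial>\<^sub>b g / \<partial>\<^sub>d\<^sub>d g\<close>. Hence the Gram determinant is \<open>det (P (I + v v\<^sup>T) P\<^sup>T)\<close>,
  which is \<open>(det P)\<^sup>2 (1 + \<bar>v\<bar>\<^sup>2) = (J_tilde Gamma_tilde)\<^sup>2\<close>. Finally, if all diagonal entries of \<open>L\<close> exceed
  \<open>sqrt \<delta>\<close> and \<open>i\<close> is the last index with \<open>a\<^sub>i \<noteq> 0\<close>, then \<open>\<bar>L a\<bar>\<^sup>2 \<ge> (l\<^sub>i\<^sub>i a\<^sub>i)\<^sup>2 > \<delta>\<close>.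
\<close>

section \<open>Schur complements and Cholesky factors\<close>

text \<open>For \<open>j, l \<ge> k\<close>, this is an entry of the Schur complement of the leading \<open>k\<close> by \<open>k\<close> block of \<open>A\<close>.\<close>

primrec schur :: "(nat \<Rightarrow> nat \<Rightarrow> real) \<Rightarrow> nat \<Rightarrow> nat \<Rightarrow> nat \<Rightarrow> real" where
  "schur A 0 j l = A j l"
| "schur A (Suc k) j l = schur A k j l - schur A k k j * schur A k k l / schur A k k k"

text \<open>The entries of the upper triangular Cholesky factor as Gaussian elimination produces
  them; \<open>chol_entry_gram\<close> and \<open>chol_entry_of_gram\<close> justify the
  name.\<close>

definition chol_entry :: "(nat \<Rightarrow> nat \<Rightarrow> real) \<Rightarrow> nat \<Rightarrow> nat \<Rightarrow> real" where
  "chol_entry A i j = schur A i i j / sqrt (schur A i i i)"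

lemma schur_sym:
  assumes "\<And>j l. A j l = A l j"
  shows "schur A k j l = schur A k l j"
  using assms by (induction k arbitrary: j l) (auto simp: mult.commute)

text \<open>Step \<open>k\<close> clears row \<open>k\<close>. Later steps keep a cleared row
  \<open>j\<close>, because the subtracted term has the factor \<open>schur A k k j\<close>, which
  by symmetry is itself an entry of row \<open>j\<close>.\<close>

lemma schur_eq_0:
  assumes "\<And>j l. A j l = A l j" "\<And>m. m < k \<Longrightarrow> schur A m m m \<noteq> 0" "j < k"
  shows "schur A k j l = 0"
  using assms(2,3)
proof (induction k arbitrary: j l)
  case (Suc k)
  show ?case
  proof (cases "j = k")
    case True
    then show ?thesis using Suc.prems by simp
  next
    case False
    then have "j < k" using Suc.prems by simp
    then have "schur A k j l' = 0" for l' using Suc by simp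
    then show ?thesis using schur_sym[of A k k j, OF assms(1)] by simp
  qed
qed simp

text \<open>Each elimination step subtracts the rank one matrix formed by one row of the factor, so
  the identity telescopes. With \<open>k\<close> below the dimension it writes a single pivot as an
  entry of \<open>A\<close> minus products from earlier rows, which is how changes of pivots are
  computed later.\<close>

lemma schur_sum:
  assumes "\<And>m. m < k \<Longrightarrow> schur A m m m > 0"
  shows "A j l = schur A k j l + (\<Sum>m<k. chol_entry A m j * chol_entry A m l)"
  using assms
proof (induction k)
  case (Suc k)
  have "schur A k k k > 0" using Suc.prems by simp
  then have "chol_entry A k j * chol_entry A k l = schur A k k j * schur A k k l / schur A k k k"
    by (simp add: chol_entry_def)
  then show ?case using Suc by simp
qed simp

lemma chol_entry_eq_0:
  assumes "\<And>j l. A j l = A l j" "\<And>m. m < i \<Longrightarrow> schur A m m m \<noteq> 0" "j < i"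
  shows "chol_entry A i j = 0"
proof -
  have "schur A i i j = schur A i j i" by (rule schur_sym[OF assms(1)])
  also have "\<dots> = 0" by (rule schur_eq_0[OF assms])
  finally show ?thesis by (simp add: chol_entry_def)
qed

lemma chol_entry_diag: "schur A i i i > 0 \<Longrightarrow> chol_entry A i i = sqrt (schur A i i i)"
  by (simp add: chol_entry_def real_div_sqrt)

lemma chol_entry_gram:
  assumes "\<And>j l. A j l = A l j" "\<And>m. m < d \<Longrightarrow> schur A m m m > 0" "j < d"
  shows "A j l = (\<Sum>m<d. chol_entry A m j * chol_entry A m l)"
proof -
  have "schur A d j l = 0"
    by (rule schur_eq_0[OF assms(1)]) (use assms(2,3) in force)+
  then show ?thesis using schur_sum[of d A j l] assms(2) by simp
qed

lemma schur_cong: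
  assumes "\<And>p q. p \<le> i \<Longrightarrow> q \<in> I \<Longrightarrow> A p q = B p q" "{..i} \<subseteq> I" "k \<le> i" "p \<le> i" "q \<in> I"
  shows "schur A k p q = schur B k p q"
  using assms(3-)
proof (induction k arbitrary: p q)
  case 0
  then show ?case using assms(1) by simp
next
  case (Suc k)
  have "k \<le> i" "k \<in> I" "p \<in> I" using Suc.prems assms(2) by auto
  then show ?case using Suc by simp
qed

lemma chol_entry_cong:
  assumes "\<And>p q. p \<le> i \<Longrightarrow> q \<le> i \<or> q = j \<Longrightarrow> A p q = B p q"
  shows "chol_entry A i j = chol_entry B i j"
proof -
  have "schur A i i q = schur B i i q" if "q \<le> i \<or> q = j" for q
    by (rule schur_cong[of i "{..i} \<union> {j}"]) (use assms that in auto)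
  then show ?thesis by (simp add: chol_entry_def)
qed

text \<open>Since \<open>T\<close> is triangular, row \<open>k\<close> of the \<open>k\<close>-th
  complement is \<open>T k k\<close> times row \<open>k\<close> of \<open>T\<close>; one elimination
  step therefore deletes exactly that row from the Gram sum.\<close>

lemma schur_of_gram:
  assumes A: "\<And>j l. j < d \<Longrightarrow> l < d \<Longrightarrow> A j l = (\<Sum>m<d. T m j * T m l)"
    and T0: "\<And>m j. j < m \<Longrightarrow> m < d \<Longrightarrow> T m j = 0"
    and pos: "\<And>m. m < d \<Longrightarrow> T m m \<noteq> 0"
    and "k \<le> d" "j < d" "l < d"
  shows "schur A k j l = (\<Sum>m=k..<d. T m j * T m l)"
  using assms(4-)
proof (induction k arbitrary: j l)
  case 0
  then show ?case by (simp add: A atLeast0LessThan)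
next
  case (Suc k)
  have k: "schur A k k q = T k k * T k q" if "q < d" for q
  proof -
    have "schur A k k q = (\<Sum>m=k..<d. T m k * T m q)" using Suc that by simp
    also have "\<dots> = T k k * T k q + (\<Sum>m=Suc k..<d. T m k * T m q)"
      using Suc.prems by (simp add: sum.atLeast_Suc_lessThan)
    also have "(\<Sum>m=Suc k..<d. T m k * T m q) = 0"
      by (rule sum.neutral) (auto simp: T0)
    finally show ?thesis by simp
  qed
  have "schur A k j l = T k j * T k l + (\<Sum>m=Suc k..<d. T m j * T m l)"
    using Suc by (simp add: sum.atLeast_Suc_lessThan)
  then show ?case using Suc.prems pos[of k] by (simp add: k)
qed

lemma schur_row_of_gram:
  assumes "\<And>j l. j < d \<Longrightarrow> l < d \<Longrightarrow> A j l = (\<Sum>m<d. T m j * T m l)"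
    and T0: "\<And>m j. j < m \<Longrightarrow> m < d \<Longrightarrow> T m j = 0"
    and "\<And>m. m < d \<Longrightarrow> T m m \<noteq> 0"
    and "i < d" "j < d"
  shows "schur A i i j = T i i * T i j"
proof -
  have "schur A i i j = (\<Sum>m=i..<d. T m i * T m j)"
    by (rule schur_of_gram[OF assms(1-3)]) (use assms in auto)
  also have "\<dots> = T i i * T i j + (\<Sum>m=Suc i..<d. T m i * T m j)"
    using assms by (simp add: sum.atLeast_Suc_lessThan)
  also have "(\<Sum>m=Suc i..<d. T m i * T m j) = 0"
    by (rule sum.neutral) (auto simp: T0)
  finally show ?thesis by simp
qed

text \<open>Uniqueness of the Cholesky factor: elimination determines each row of \<open>T\<close>
  up to sign, and the positive diagonal fixes the sign.\<close>

lemma chol_entry_of_gram: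
  assumes "\<And>j l. j < d \<Longrightarrow> l < d \<Longrightarrow> A j l = (\<Sum>m<d. T m j * T m l)"
    and "\<And>m j. j < m \<Longrightarrow> m < d \<Longrightarrow> T m j = 0"
    and pos: "\<And>m. m < d \<Longrightarrow> T m m > 0"
    and "i < d" "j < d"
  shows "chol_entry A i j = T i j"
proof -
  have ne: "T m m \<noteq> 0" if "m < d" for m using pos[OF that] by simp
  show ?thesis
    using schur_row_of_gram[OF assms(1,2) ne, of i j] schur_row_of_gram[OF assms(1,2) ne, of i i]
      assms(4,5) pos[OF assms(4)]
    by (simp add: chol_entry_def)
qed

text \<open>A vector supported on indices above \<open>k\<close> is extended by the entry \<open>a k\<close> that minimizes the
  quadratic form; the minimum is the form of the Schur complement.\<close>

lemma schur_pos:
  assumes sym: "\<And>j l. A j l = A l j"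
    and pd: "\<And>a. \<exists>j<d. a j \<noteq> 0 \<Longrightarrow> (\<Sum>j<d. \<Sum>l<d. a j * a l * A j l) > 0"
    and "k < d"
  shows "schur A k k k > 0"
proof -
  have "\<forall>a. (\<exists>j\<in>{k..<d}. a j \<noteq> 0) \<longrightarrow> (\<Sum>j=k..<d. \<Sum>l=k..<d. a j * a l * schur A k j l) > 0"
    if "k \<le> d" for k
    using that
  proof (induction k)
    case 0
    then show ?case using pd by (auto simp: atLeast0LessThan Bex_def)
  next
    case (Suc k)
    define B where "B = schur A k"
    have Bsym: "B j l = B l j" for j l unfolding B_def by (rule schur_sym[OF sym])
    have k: "{k..<d} = insert k {Suc k..<d}" using Suc.prems by auto
    have IH: "(\<Sum>j=k..<d. \<Sum>l=k..<d. a j * a l * B j l) > 0" if "\<exists>j\<in>{k..<d}. a j \<noteq> 0" for a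
      using Suc that unfolding B_def by simp
    have split: "(\<Sum>j=k..<d. \<Sum>l=k..<d. a j * a l * B j l) =
       (a k)\<^sup>2 * B k k + 2 * a k * (\<Sum>l=Suc k..<d. a l * B k l)
       + (\<Sum>j=Suc k..<d. \<Sum>l=Suc k..<d. a j * a l * B j l)" for a
    proof -
      have "(\<Sum>l=Suc k..<d. a k * a l * B k l) = a k * (\<Sum>l=Suc k..<d. a l * B k l)"
        by (simp add: sum_distrib_left mult.assoc)
      moreover have "(\<Sum>j=Suc k..<d. a j * a k * B j k) = a k * (\<Sum>l=Suc k..<d. a l * B k l)"
        unfolding sum_distrib_left by (rule sum.cong) (simp_all add: Bsym[of k])
      ultimately show ?thesis by (simp add: k sum.distrib power2_eq_square)
    qed
    have "(\<Sum>j=k..<d. \<Sum>l=k..<d. (if j = k then 1 else 0) * (if l = k then 1 else 0) * B j l) > 0"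
      by (rule IH) (use Suc.prems in auto)
    then have Bk: "B k k > 0" by (simp add: split)
    show ?case
    proof (intro allI impI)
      fix a :: "nat \<Rightarrow> real" assume a: "\<exists>j\<in>{Suc k..<d}. a j \<noteq> 0"
      define w where "w = (\<Sum>l=Suc k..<d. a l * B k l)"
      define a' where "a' = a(k := - w / B k k)"
      have "0 < (\<Sum>j=k..<d. \<Sum>l=k..<d. a' j * a' l * B j l)"
      proof (rule IH)
        obtain j where "j \<in> {Suc k..<d}" "a j \<noteq> 0" using a by blast
        then show "\<exists>j\<in>{k..<d}. a' j \<noteq> 0" by (auto simp: a'_def intro!: bexI[of _ j])
      qed
      also have "\<dots> = (a' k)\<^sup>2 * B k k + 2 * a' k * w
         + (\<Sum>j=Suc k..<d. \<Sum>l=Suc k..<d. a j * a l * B j l)"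
        unfolding split by (simp add: a'_def w_def)
      also have "(a' k)\<^sup>2 * B k k + 2 * a' k * w = - (w * w / B k k)"
        using Bk by (simp add: a'_def power2_eq_square field_simps)
      also have "w * w = (\<Sum>j=Suc k..<d. \<Sum>l=Suc k..<d. (a j * B k j) * (a l * B k l))"
        unfolding w_def by (rule sum_product)
      also have "- (\<dots> / B k k) + (\<Sum>j=Suc k..<d. \<Sum>l=Suc k..<d. a j * a l * B j l) =
          (\<Sum>j=Suc k..<d. \<Sum>l=Suc k..<d. a j * a l * schur A (Suc k) j l)"
        by (simp add: B_def sum_subtractf sum_divide_distrib algebra_simps)
      finally show "(\<Sum>j=Suc k..<d. \<Sum>l=Suc k..<d. a j * a l * schur A (Suc k) j l) > 0" .
    qed
  qed
  from this[of k, THEN spec, of "\<lambda>j. if j = k then 1 else 0"] assms(3)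
  have "0 < (\<Sum>j=k..<d. \<Sum>l=k..<d. (if j = k then 1 else 0) * (if l = k then 1 else 0) * schur A k j l)"
    by auto
  also have "\<dots> = schur A k k k"
  proof -
    have "{k..<d} = insert k {Suc k..<d}" using assms(3) by auto
    then show ?thesis by simp
  qed
  finally show ?thesis .
qed

section \<open>Gram determinants of rank one perturbations\<close>

text \<open>The Gram determinant is defined by permutations of an arbitrary index set. An
  enumeration carries it to a matrix determinant, as conjugating permutations preserves the
  sign.\<close>

lemma leibniz_reindex:
  fixes A :: "'i \<Rightarrow> 'i \<Rightarrow> real"
  assumes e: "bij_betw e {0..<n} K"
  shows "(\<Sum>\<pi> | \<pi> permutes K. of_int (sign \<pi>) * (\<Prod>a\<in>K. A a (\<pi> a))) =
    Determinant.det (mat n n (\<lambda>(i, j). A (e i) (e j)))"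
proof -
  define m where "m = map_permutation {0..<n} e"
  have inj: "inj_on e {0..<n}" and im: "e ` {0..<n} = K"
    using e by (auto simp: bij_betw_def)
  have "bij_betw m {\<pi>. \<pi> permutes {0..<n}} {\<pi>. \<pi> permutes K}"
  proof -
    \<comment> \<open>Written out, \<open>m\<close> conjugates by \<open>e\<close> on
      \<open>K\<close> and fixes everything else.\<close>
    have "m \<pi> = (\<lambda>x. if x \<in> K then e (\<pi> (inv_into {0..<n} e x)) else x)" for \<pi>
      by (auto simp: m_def map_permutation_def im restrict_id_def)
    then show ?thesis using bij_betw_permutations[OF e] by (simp cong: bij_betw_cong)
  qed
  then have "(\<Sum>\<pi> | \<pi> permutes K. of_int (sign \<pi>) * (\<Prod>a\<in>K. A a (\<pi> a))) =
      (\<Sum>\<pi> | \<pi> permutes {0..<n}. of_int (sign (m \<pi>)) * (\<Prod>a\<in>K. A a (m \<pi> a)))"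
    by (rule sum.reindex_bij_betw[symmetric])
  also have "\<dots> = (\<Sum>\<pi> | \<pi> permutes {0..<n}. signof \<pi> * (\<Prod>i=0..<n. A (e i) (e (\<pi> i))))"
  proof (rule sum.cong)
    fix \<pi> assume \<pi>: "\<pi> \<in> {\<pi>. \<pi> permutes {0..<n}}"
    have "(\<Prod>a\<in>K. A a (m \<pi> a)) = (\<Prod>i=0..<n. A (e i) (m \<pi> (e i)))"
      by (rule prod.reindex_bij_betw[OF e, symmetric])
    also have "\<dots> = (\<Prod>i=0..<n. A (e i) (e (\<pi> i)))"
      by (rule prod.cong) (auto simp: m_def map_permutation_apply[OF inj])
    finally show "of_int (sign (m \<pi>)) * (\<Prod>a\<in>K. A a (m \<pi> a)) =
        signof \<pi> * (\<Prod>i=0..<n. A (e i) (e (\<pi> i)))"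
      using \<pi> inj by (simp add: m_def sign_map_permutation)
  qed simp
  also have "\<dots> = (\<Sum>\<pi> | \<pi> permutes {0..<n}.
      signof \<pi> * (\<Prod>i=0..<n. mat n n (\<lambda>(i, j). A (e i) (e j)) $$ (i, \<pi> i)))"
  proof (intro sum.cong arg_cong2[where f = "(*)"] prod.cong refl)
    fix \<pi> i assume "\<pi> \<in> {\<pi>. \<pi> permutes {0..<n}}" "i \<in> {0..<n}"
    then have "\<pi> i < n" "i < n" using permutes_in_image[of \<pi> "{0..<n}" i] by auto
    then show "A (e i) (e (\<pi> i)) = mat n n (\<lambda>(i, j). A (e i) (e j)) $$ (i, \<pi> i)" by simp
  qed
  also have "\<dots> = Determinant.det (mat n n (\<lambda>(i, j). A (e i) (e j)))"
    by (rule det_def'[symmetric]) simp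
  finally show ?thesis .
qed

text \<open>The matrix determinant lemma. The block matrices below satisfy
  \<open>X * Y = Z * X\<close> with \<open>det X = 1\<close>, and \<open>det Y\<close>,
  \<open>det Z\<close> are the two sides.\<close>

lemma det_one_plus_rank_one:
  fixes U V :: "real mat"
  assumes U: "U \<in> carrier_mat n 1" and V: "V \<in> carrier_mat 1 n"
  shows "Determinant.det (1\<^sub>m n + U * V) = 1 + (V * U) $$ (0, 0)"
proof -
  note c = U V mult_carrier_mat[OF U V] mult_carrier_mat[OF V U]
  have mm: "(V * U) * V = V * (U * V)" using c by simp
  define X where "X = four_block_mat (1\<^sub>m n) (0\<^sub>m n 1) V (1\<^sub>m 1)"
  define Y where "Y = four_block_mat (1\<^sub>m n + U * V) U (0\<^sub>m 1 n) (1\<^sub>m 1)"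
  define Z where "Z = four_block_mat (1\<^sub>m n) U (0\<^sub>m 1 n) (1\<^sub>m 1 + V * U)"
  have carr: "X \<in> carrier_mat (n + 1) (n + 1)" "Y \<in> carrier_mat (n + 1) (n + 1)"
      "Z \<in> carrier_mat (n + 1) (n + 1)"
    using c unfolding X_def Y_def Z_def by auto
  have "X * Y = four_block_mat (1\<^sub>m n + U * V) U (V * (1\<^sub>m n + U * V)) (V * U + 1\<^sub>m 1)"
    unfolding X_def Y_def using c
    by (subst mult_four_block_mat[of _ n n _ 1 _ 1 _ _ n _ 1]) auto
  also have "V * (1\<^sub>m n + U * V) = V + (V * U) * V"
    using c by (subst mult_add_distrib_mat[of V 1 n]) (auto simp: mm)
  also have "V + (V * U) * V = (1\<^sub>m 1 + V * U) * V"
    using c by (subst add_mult_distrib_mat[of _ 1 1]) auto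
  also have "four_block_mat (1\<^sub>m n + U * V) U \<dots> (V * U + 1\<^sub>m 1) = Z * X"
    unfolding X_def Z_def using c
    by (subst mult_four_block_mat[of _ n n _ 1 _ 1 _ _ n _ 1]) (auto simp: comm_add_mat[of _ 1 1])
  finally have "Determinant.det X * Determinant.det Y = Determinant.det Z * Determinant.det X"
    using carr det_mult by metis
  moreover have "Determinant.det X = 1"
    unfolding X_def using c by (subst det_four_block_mat_upper_right_zero) auto
  moreover have "Determinant.det Y = Determinant.det (1\<^sub>m n + U * V)"
    unfolding Y_def using c by (subst det_four_block_mat_lower_left_zero) auto
  moreover have "Determinant.det Z = Determinant.det (1\<^sub>m 1 + V * U)"
    unfolding Z_def using c by (subst det_four_block_mat_lower_left_zero) auto
  moreover have "Determinant.det (1\<^sub>m 1 + V * U) = 1 + (V * U) $$ (0, 0)"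
    using c by (subst det_single) auto
  ultimately show ?thesis by simp
qed

text \<open>With \<open>w = P v\<close>, the Gram matrix is \<open>P (I + v v\<^sup>T) P\<^sup>T\<close>.\<close>

lemma leibniz_gram_rank_one:
  fixes P :: "'i \<Rightarrow> 'i \<Rightarrow> real" and v w :: "'i \<Rightarrow> real" and r :: "'i \<Rightarrow> nat"
  assumes fin: "finite K" and r: "inj_on r K"
    and tri: "\<And>a b. a \<in> K \<Longrightarrow> b \<in> K \<Longrightarrow> r b < r a \<Longrightarrow> P a b = 0"
    and w: "\<And>a. a \<in> K \<Longrightarrow> w a = (\<Sum>j\<in>K. P a j * v j)"
    and G: "\<And>a b. a \<in> K \<Longrightarrow> b \<in> K \<Longrightarrow> G a b = (\<Sum>j\<in>K. P a j * P b j) + w a * w b"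
  shows "(\<Sum>\<pi> | \<pi> permutes K. of_int (sign \<pi>) * (\<Prod>a\<in>K. G a (\<pi> a))) =
    (\<Prod>a\<in>K. P a a)\<^sup>2 * (1 + (\<Sum>j\<in>K. (v j)\<^sup>2))"
proof -
  \<comment> \<open>Enumerating \<open>K\<close> by increasing \<open>r\<close> makes the matrix of
    \<open>P\<close> upper triangular.\<close>
  define xs where "xs = sorted_list_of_set (r ` K)"
  define n where "n = card K"
  define e where "e = inv_into K r \<circ> (!) xs"
  have xs: "sorted_wrt (<) xs" "set xs = r ` K" "length xs = n"
    using fin r by (auto simp: xs_def n_def card_image)
  have bij_xs: "bij_betw ((!) xs) {0..<n} (r ` K)"
    using bij_betw_nth[of xs "{0..<n}" "r ` K"] xs
    by (simp add: atLeast0LessThan strict_sorted_iff)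
  then have e: "bij_betw e {0..<n} K"
    unfolding e_def by (rule bij_betw_trans[OF _ bij_betw_inv_into[OF inj_on_imp_bij_betw[OF r]]])
  have re: "r (e i) = xs ! i" if "i < n" for i
    using that xs nth_mem[of i xs] by (simp add: e_def f_inv_into_f)
  have e_less: "r (e i) < r (e j)" if "i < j" "j < n" for i j
    using xs that by (simp add: re sorted_wrt_nth_less)
  have eK: "e i \<in> K" if "i < n" for i using e that by (auto simp: bij_betw_def)
  have sum_e: "(\<Sum>j\<in>K. f j) = (\<Sum>i=0..<n. f (e i))" for f :: "'i \<Rightarrow> real"
    by (rule sum.reindex_bij_betw[OF e, symmetric])
  define Pm where "Pm = mat n n (\<lambda>(i, j). P (e i) (e j))"
  define V where "V = mat 1 n (\<lambda>(i, j). v (e j))"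
  define U where "U = mat n 1 (\<lambda>(i, j). v (e i))"
  have c: "Pm \<in> carrier_mat n n" "V \<in> carrier_mat 1 n" "U \<in> carrier_mat n 1"
      "U * V \<in> carrier_mat n n" "transpose_mat Pm \<in> carrier_mat n n"
    by (auto simp: Pm_def V_def U_def)
  have "mat n n (\<lambda>(i, j). G (e i) (e j)) = Pm * (1\<^sub>m n + U * V) * transpose_mat Pm"
  proof -
    have PU: "(Pm * U) $$ (i, 0) = w (e i)" if "i < n" for i
      using that c w[OF eK[OF that]] by (simp add: scalar_prod_def Pm_def U_def sum_e)
    have "U = transpose_mat V" by (auto simp: U_def V_def)
    then have VP: "V * transpose_mat Pm = transpose_mat (Pm * U)"
      using c by (simp add: transpose_mult[of _ n n _ 1])
    have "Pm * (1\<^sub>m n + U * V) * transpose_mat Pm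
        = Pm * transpose_mat Pm + (Pm * U) * (V * transpose_mat Pm)"
      using c by (simp add: mult_add_distrib_mat[of _ n n] add_mult_distrib_mat[of _ n n]
        assoc_mult_mat[of _ n n _ 1 _ n] assoc_mult_mat[of _ n 1 _ n _ n] assoc_mult_mat[of _ n n _ n _ n])
    also have "\<dots> = mat n n (\<lambda>(i, j). G (e i) (e j))"
    proof (rule eq_matI)
      fix i j assume ij: "i < dim_row (mat n n (\<lambda>(i, j). G (e i) (e j)))"
        "j < dim_col (mat n n (\<lambda>(i, j). G (e i) (e j)))"
      then have ij': "i < n" "j < n" by auto
      have 1: "(Pm * transpose_mat Pm) $$ (i, j) = (\<Sum>k\<in>K. P (e i) k * P (e j) k)"
        using ij' c by (simp add: scalar_prod_def Pm_def sum_e)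
      have 2: "((Pm * U) * (V * transpose_mat Pm)) $$ (i, j) = w (e i) * w (e j)"
        unfolding VP using ij' c PU[OF ij'(1)] PU[OF ij'(2)]
        by (subst index_mult_mat) (auto simp: scalar_prod_def)
      show "(Pm * transpose_mat Pm + (Pm * U) * (V * transpose_mat Pm)) $$ (i, j)
          = mat n n (\<lambda>(i, j). G (e i) (e j)) $$ (i, j)"
        using ij' c 1 2 G[OF eK eK] by simp
    qed (use c in auto)
    finally show ?thesis by simp
  qed
  moreover have "Determinant.det (Pm * (1\<^sub>m n + U * V) * transpose_mat Pm)
      = Determinant.det Pm * Determinant.det (1\<^sub>m n + U * V) * Determinant.det Pm"
    using c by (simp add: det_mult[of _ n] det_transpose)
  moreover have "Determinant.det (1\<^sub>m n + U * V) = 1 + (\<Sum>j\<in>K. (v j)\<^sup>2)"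
    using c by (subst det_one_plus_rank_one)
      (auto simp: scalar_prod_def U_def V_def sum_e power2_eq_square)
  moreover have "Determinant.det Pm = (\<Prod>a\<in>K. P a a)"
  proof -
    have "upper_triangular Pm"
      using e_less tri eK by (auto simp: upper_triangular_def Pm_def)
    then have "Determinant.det Pm = prod_list (diag_mat Pm)"
      using c det_upper_triangular by blast
    also have "\<dots> = (\<Prod>i=0..<n. Pm $$ (i, i))" using c by (simp add: prod_list_diag_prod)
    also have "\<dots> = (\<Prod>i=0..<n. P (e i) (e i))" by (rule prod.cong) (auto simp: Pm_def)
    also have "\<dots> = (\<Prod>a\<in>K. P a a)" by (rule prod.reindex_bij_betw[OF e])
    finally show ?thesis .
  qed
  ultimately show ?thesis
    unfolding leibniz_reindex[OF e] by (simp add: power2_eq_square mult_ac)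
qed

section \<open>Differentiation in coordinates\<close>

text \<open>Tailored to \<open>local_param\<close>: a derivative along every coordinate line,
  jointly continuous on \<open>U\<close>. The derivative is asserted to exist, because
  \<open>partial\<close> alone, being built on \<open>deriv\<close>, says nothing about
  existence.\<close>

definition C1_on :: "'i set \<Rightarrow> ('i \<Rightarrow> real) set \<Rightarrow> (('i \<Rightarrow> real) \<Rightarrow> real) \<Rightarrow> bool" where
  "C1_on K U F \<longleftrightarrow> continuous_on U F \<and>
     (\<forall>a\<in>K. \<exists>F'. continuous_on U F' \<and>
        (\<forall>x\<in>U. ((\<lambda>s. F (x(a := s))) has_real_derivative F' x) (at (x a))))"

lemma C1_on_continuous: "C1_on K U F \<Longrightarrow> continuous_on U F"
  by (simp add: C1_on_def)

lemma C1_on_subset: "C1_on K U F \<Longrightarrow> V \<subseteq> U \<Longrightarrow> C1_on K V F"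
  unfolding C1_on_def by (meson continuous_on_subset subsetD)

lemma C1_on_partial:
  assumes "C1_on K U F" "a \<in> K" "x \<in> U"
  shows "((\<lambda>s. F (x(a := s))) has_real_derivative partial a F x) (at (x a))"
  using assms by (force simp: C1_on_def partial_def DERIV_imp_deriv)

lemma C1_on_continuous_partial:
  assumes "C1_on K U F" "a \<in> K"
  shows "continuous_on U (partial a F)"
proof -
  obtain F' where F': "continuous_on U F'"
    "\<And>x. x \<in> U \<Longrightarrow> ((\<lambda>s. F (x(a := s))) has_real_derivative F' x) (at (x a))"
    using assms unfolding C1_on_def by blast
  have "partial a F x = F' x" if "x \<in> U" for x
    unfolding partial_def using F'(2)[OF that] by (rule DERIV_imp_deriv)
  then show ?thesis using F'(1) continuous_on_cong by metis
qed

lemma C1_onI: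
  assumes "continuous_on U F" "\<And>a. a \<in> K \<Longrightarrow> continuous_on U (F' a)"
    "\<And>a x. a \<in> K \<Longrightarrow> x \<in> U \<Longrightarrow> ((\<lambda>s. F (x(a := s))) has_real_derivative F' a x) (at (x a))"
  shows "C1_on K U F"
  using assms unfolding C1_on_def by blast

lemma C1_on_const: "C1_on K U (\<lambda>x. c)"
  by (rule C1_onI[where F' = "\<lambda>_ _. 0"]) auto

lemma C1_on_coord: "C1_on K U (\<lambda>x. x j)"
proof (rule C1_onI[where F' = "\<lambda>a _. if a = j then 1 else 0"])
  show "continuous_on U (\<lambda>x. x j)"
    by (rule continuous_on_product_then_coordinatewise) (rule continuous_on_id)
qed auto

lemma C1_on_add:
  assumes "C1_on K U F" "C1_on K U G"
  shows "C1_on K U (\<lambda>x. F x + G x)"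
  by (rule C1_onI[where F' = "\<lambda>a x. partial a F x + partial a G x"])
    (auto intro!: continuous_on_add DERIV_add assms[THEN C1_on_partial]
      assms[THEN C1_on_continuous] assms[THEN C1_on_continuous_partial])

lemma C1_on_mult:
  assumes "C1_on K U F" "C1_on K U G"
  shows "C1_on K U (\<lambda>x. F x * G x)"
proof (rule C1_onI[where F' = "\<lambda>a x. partial a F x * G x + partial a G x * F x"])
  fix a x assume ax: "a \<in> K" "x \<in> U"
  show "((\<lambda>s. F (x(a := s)) * G (x(a := s))) has_real_derivative
      partial a F x * G x + partial a G x * F x) (at (x a))"
    using DERIV_mult[OF C1_on_partial[OF assms(1) ax] C1_on_partial[OF assms(2) ax]] by simp
qed (auto intro!: continuous_on_add continuous_on_mult
  assms[THEN C1_on_continuous] assms[THEN C1_on_continuous_partial])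

lemma C1_on_inverse:
  assumes "C1_on K U F" "\<And>x. x \<in> U \<Longrightarrow> F x \<noteq> 0"
  shows "C1_on K U (\<lambda>x. inverse (F x))"
proof (rule C1_onI[where F' = "\<lambda>a x. - (partial a F x * inverse ((F x)\<^sup>2))"])
  fix a x assume "a \<in> K" "x \<in> U"
  then show "((\<lambda>s. inverse (F (x(a := s)))) has_real_derivative
      - (partial a F x * inverse ((F x)\<^sup>2))) (at (x a))"
    using DERIV_inverse_fun[OF C1_on_partial[OF assms(1)]] assms(2)
    by (simp add: power2_eq_square)
qed (use assms(2) in \<open>auto intro!: continuous_intros C1_on_continuous[OF assms(1)]
  C1_on_continuous_partial[OF assms(1)]\<close>)

lemma C1_on_sqrt:
  assumes "C1_on K U F" "\<And>x. x \<in> U \<Longrightarrow> F x > 0"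
  shows "C1_on K U (\<lambda>x. sqrt (F x))"
proof (rule C1_onI[where F' = "\<lambda>a x. partial a F x * (inverse (sqrt (F x)) / 2)"])
  fix a x assume ax: "a \<in> K" "x \<in> U"
  show "((\<lambda>s. sqrt (F (x(a := s)))) has_real_derivative
      partial a F x * (inverse (sqrt (F x)) / 2)) (at (x a))"
    using C1_on_partial[OF assms(1) ax] assms(2)[OF ax(2)]
    by (auto intro!: derivative_eq_intros)
next
  have "sqrt (F x) \<noteq> 0" if "x \<in> U" for x using assms(2)[OF that] by simp
  then show "continuous_on U (\<lambda>x. partial a F x * (inverse (sqrt (F x)) / 2))" if "a \<in> K" for a
    using that by (auto intro!: continuous_intros C1_on_continuous[OF assms(1)]
      C1_on_continuous_partial[OF assms(1)])
qed (auto intro!: continuous_intros C1_on_continuous[OF assms(1)])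

lemma C1_on_uminus: "C1_on K U F \<Longrightarrow> C1_on K U (\<lambda>x. - F x)"
  using C1_on_mult[OF C1_on_const[of K U "-1"]] by simp

lemma C1_on_diff: "C1_on K U F \<Longrightarrow> C1_on K U G \<Longrightarrow> C1_on K U (\<lambda>x. F x - G x)"
  using C1_on_add[OF _ C1_on_uminus] by simp

lemma C1_on_divide:
  "C1_on K U F \<Longrightarrow> C1_on K U G \<Longrightarrow> (\<And>x. x \<in> U \<Longrightarrow> G x \<noteq> 0) \<Longrightarrow> C1_on K U (\<lambda>x. F x / G x)"
  using C1_on_mult[of K U F "\<lambda>x. inverse (G x)"] C1_on_inverse[of K U G] by (simp add: divide_inverse)

lemma C1_on_sum:
  assumes "\<And>i. i \<in> I \<Longrightarrow> C1_on K U (\<lambda>x. F x i)"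
  shows "C1_on K U (\<lambda>x. \<Sum>i\<in>I. F x i)"
  using assms
  by (induction I rule: infinite_finite_induct) (auto intro: C1_on_add C1_on_const)

lemma C1_on_prod:
  assumes "\<And>i. i \<in> I \<Longrightarrow> C1_on K U (\<lambda>x. F x i)"
  shows "C1_on K U (\<lambda>x. \<Prod>i\<in>I. F x i)"
  using assms
  by (induction I rule: infinite_finite_induct) (auto intro: C1_on_mult C1_on_const)

section \<open>Relative openness, and regularity of elimination\<close>

lemma openin_Collect_pos:
  assumes "openin (top_of_set E) U" "continuous_on U F"
  shows "openin (top_of_set E) {x \<in> U. F x > (0 :: real)}"
proof -
  have "openin (top_of_set U) (U \<inter> F -` {0<..})"
    using assms(2) by (rule continuous_openin_preimage_gen) simp
  moreover have "U \<inter> F -` {0<..} = {x \<in> U. F x > 0}" by auto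
  ultimately show ?thesis using assms(1) openin_trans by metis
qed

text \<open>Changing a coordinate in \<open>K\<close> preserves extensionality, so a coordinate line
  stays in a relatively open set for a while. This permits differentiating identities that hold only
  on \<open>U\<close>.\<close>

lemma eventually_fun_upd_in_openin:
  fixes x :: "'i \<Rightarrow> real"
  assumes "openin (top_of_set (K \<rightarrow>\<^sub>E UNIV)) U" "x \<in> U" "a \<in> K"
  shows "eventually (\<lambda>s. x(a := s) \<in> U) (nhds (x a))"
proof -
  obtain V where V: "open V" "U = (K \<rightarrow>\<^sub>E UNIV) \<inter> V"
    using assms(1) by (auto simp: openin_open)
  have "continuous_on UNIV (\<lambda>s. (x(a := s)) i)" for i
    by (cases "i = a") auto
  then have "continuous_on UNIV (\<lambda>s. x(a := s))"
    by (rule continuous_on_coordinatewise_then_product)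
  then have "isCont (\<lambda>s. x(a := s)) (x a)"
    by (simp add: continuous_on_eq_continuous_at)
  then have "((\<lambda>s. x(a := s)) \<longlongrightarrow> x(a := x a)) (nhds (x a))"
    unfolding isCont_def by (subst tendsto_at_iff_tendsto_nhds[symmetric]) simp
  then have "eventually (\<lambda>s. x(a := s) \<in> V) (nhds (x a))"
    using V assms(2) by (intro topological_tendstoD) auto
  moreover have "x(a := s) \<in> K \<rightarrow>\<^sub>E UNIV" for s
    using V assms(2,3) by (auto simp: PiE_iff extensional_def)
  ultimately show ?thesis using V by simp
qed

lemma C1_on_schur:
  assumes "\<And>j l. C1_on K U (\<lambda>x. A x j l)"
    and "\<And>x m. x \<in> U \<Longrightarrow> m < k \<Longrightarrow> schur (A x) m m m \<noteq> 0"
  shows "C1_on K U (\<lambda>x. schur (A x) k j l)"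
  using assms(2)
proof (induction k arbitrary: j l)
  case (Suc k)
  then have "C1_on K U (\<lambda>x. schur (A x) k j l)" for j l by simp
  then show ?case using Suc.prems by (auto intro!: C1_on_diff C1_on_mult C1_on_divide)
qed (simp add: assms(1))

lemma C1_on_chol_entry:
  assumes "\<And>j l. C1_on K U (\<lambda>x. A x j l)"
    and pos: "\<And>x m. x \<in> U \<Longrightarrow> m \<le> i \<Longrightarrow> schur (A x) m m m > 0"
  shows "C1_on K U (\<lambda>x. chol_entry (A x) i j)"
proof -
  have ne: "schur (A x) m m m \<noteq> 0" if "x \<in> U" "m < i" for x m
    using pos[of x m] that by simp
  have "sqrt (schur (A x) i i i) \<noteq> 0" if "x \<in> U" for x
    using pos[OF that, of i] by simp
  then show ?thesis
    unfolding chol_entry_def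
    by (intro C1_on_divide C1_on_sqrt C1_on_schur[OF assms(1) ne]) (simp_all add: pos)
qed

text \<open>Pivot \<open>n\<close> is a continuous function only where the earlier pivots do not
  vanish, hence the induction that adds one pivot at a time.\<close>

lemma openin_schur_pos:
  assumes "\<And>j l. C1_on K V (\<lambda>x. A x j l)" "openin (top_of_set E) V"
  shows "openin (top_of_set E) {x \<in> V. \<forall>k<n. schur (A x) k k k > 0}"
proof (induction n)
  case (Suc n)
  define U where "U = {x \<in> V. \<forall>k<n. schur (A x) k k k > 0}"
  have "C1_on K U (\<lambda>x. schur (A x) n n n)"
  proof (rule C1_on_schur)
    show "C1_on K U (\<lambda>x. A x j l)" for j l
      using assms(1) by (rule C1_on_subset) (simp add: U_def)
    show "schur (A x) m m m \<noteq> 0" if "x \<in> U" "m < n" for x m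
      using that by (force simp: U_def)
  qed
  then have "openin (top_of_set E) {x \<in> U. schur (A x) n n n > 0}"
    using Suc.IH unfolding U_def[symmetric] by (intro openin_Collect_pos C1_on_continuous)
  also have "{x \<in> U. schur (A x) n n n > 0} = {x \<in> V. \<forall>k<Suc n. schur (A x) k k k > 0}"
    by (auto simp: U_def less_Suc_eq)
  finally show ?case .
qed (use assms(2) in simp)

text \<open>Differentiability along curves in the coordinates \<open>J\<close>, with gradient \<open>G\<close> at \<open>p\<close>. Unlike
  existence of partial derivatives, it yields the chain rule.\<close>

definition curve_deriv ::
  "'j set \<Rightarrow> (('j \<Rightarrow> real) \<Rightarrow> real) \<Rightarrow> ('j \<Rightarrow> real) \<Rightarrow> ('j \<Rightarrow> real) \<Rightarrow> bool" where
  "curve_deriv J F p G \<longleftrightarrow> (\<forall>c s c'. c s = p \<longrightarrow>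
     (\<forall>j\<in>J. ((\<lambda>u. c u j) has_real_derivative c' j) (at s)) \<longrightarrow>
     ((\<lambda>u. F (c u)) has_real_derivative (\<Sum>j\<in>J. G j * c' j)) (at s))"

lemma curve_deriv_const: "curve_deriv J (\<lambda>t. k) p (\<lambda>_. 0)"
  by (simp add: curve_deriv_def)

lemma curve_deriv_coord:
  assumes "finite J" "a \<in> J"
  shows "curve_deriv J (\<lambda>t. t a) p (\<lambda>j. if j = a then 1 else 0)"
proof -
  have "(\<Sum>j\<in>J. (if j = a then 1 else 0) * c' j) = c' a" for c' :: "'a \<Rightarrow> real"
    using assms by (simp add: if_distrib[of "\<lambda>u. u * _"] cong: if_cong)
  then show ?thesis using assms(2) by (simp add: curve_deriv_def)
qed

lemma curve_deriv_add:
  assumes "curve_deriv J F p G" "curve_deriv J F' p G'"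
  shows "curve_deriv J (\<lambda>t. F t + F' t) p (\<lambda>j. G j + G' j)"
  using assms unfolding curve_deriv_def by (simp add: distrib_right sum.distrib DERIV_add)

lemma curve_deriv_mult:
  assumes "curve_deriv J F p G" "curve_deriv J F' p G'"
  shows "curve_deriv J (\<lambda>t. F t * F' t) p (\<lambda>j. G j * F' p + G' j * F p)"
  unfolding curve_deriv_def
proof (intro allI impI)
  fix c :: "real \<Rightarrow> 'a \<Rightarrow> real" and s c'
  assume c: "c s = p" "\<forall>j\<in>J. ((\<lambda>u. c u j) has_real_derivative c' j) (at s)"
  have "((\<lambda>u. F (c u) * F' (c u)) has_real_derivative
      (\<Sum>j\<in>J. G j * c' j) * F' (c s) + (\<Sum>j\<in>J. G' j * c' j) * F (c s)) (at s)"
    using assms c unfolding curve_deriv_def by (intro DERIV_mult) auto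
  then show "((\<lambda>u. F (c u) * F' (c u)) has_real_derivative
      (\<Sum>j\<in>J. (G j * F' p + G' j * F p) * c' j)) (at s)"
    by (simp add: c(1) sum.distrib sum_distrib_left algebra_simps)
qed

text \<open>Existential forms suffice, since \<open>curve_deriv_partial\<close> identifies any
  gradient with the partial derivatives afterwards.\<close>

lemma curve_deriv_ex_const: "\<exists>G. curve_deriv J (\<lambda>t. k) p G"
  using curve_deriv_const by blast

lemma curve_deriv_ex_add:
  "\<exists>G. curve_deriv J F p G \<Longrightarrow> \<exists>G. curve_deriv J F' p G \<Longrightarrow>
   \<exists>G. curve_deriv J (\<lambda>t. F t + F' t) p G"
  using curve_deriv_add by blast

lemma curve_deriv_ex_mult:
  "\<exists>G. curve_deriv J F p G \<Longrightarrow> \<exists>G. curve_deriv J F' p G \<Longrightarrow>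
   \<exists>G. curve_deriv J (\<lambda>t. F t * F' t) p G"
  using curve_deriv_mult by blast

lemma curve_deriv_sum:
  assumes "\<And>i. i \<in> I \<Longrightarrow> \<exists>G. curve_deriv J (\<lambda>t. F t i) p G"
  shows "\<exists>G. curve_deriv J (\<lambda>t. \<Sum>i\<in>I. F t i) p G"
  using assms
proof (induction I rule: infinite_finite_induct)
  case (insert i I)
  then obtain G G' where "curve_deriv J (\<lambda>t. F t i) p G" "curve_deriv J (\<lambda>t. \<Sum>i\<in>I. F t i) p G'"
    by (meson insertI1 insertI2)
  from curve_deriv_add[OF this] show ?case using insert.hyps by auto
qed (auto intro: curve_deriv_const)

lemma curve_deriv_prod:
  assumes "\<And>i. i \<in> I \<Longrightarrow> \<exists>G. curve_deriv J (\<lambda>t. F t i) p G"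
  shows "\<exists>G. curve_deriv J (\<lambda>t. \<Prod>i\<in>I. F t i) p G"
  using assms
proof (induction I rule: infinite_finite_induct)
  case (insert i I)
  then obtain G G' where "curve_deriv J (\<lambda>t. F t i) p G" "curve_deriv J (\<lambda>t. \<Prod>i\<in>I. F t i) p G'"
    by (meson insertI1 insertI2)
  from curve_deriv_mult[OF this] show ?case using insert.hyps by auto
qed (auto intro: curve_deriv_const)

lemma curve_deriv_partial:
  assumes "finite J" "curve_deriv J F p G" "a \<in> J"
  shows "((\<lambda>s. F (p(a := s))) has_real_derivative G a) (at (p a))"
    and "partial a F p = G a"
proof -
  have "((\<lambda>u. F (p(a := u))) has_real_derivative (\<Sum>j\<in>J. G j * (if j = a then 1 else 0))) (at (p a))"
    using assms(2)[unfolded curve_deriv_def, rule_format, of "\<lambda>u. p(a := u)" "p a" "\<lambda>j. if j = a then 1 else 0"]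
    by auto
  then show *: "((\<lambda>s. F (p(a := s))) has_real_derivative G a) (at (p a))"
    using assms(1,3) by (simp add: if_distrib[of "\<lambda>u. _ * u"] cong: if_cong)
  then show "partial a F p = G a" unfolding partial_def by (rule DERIV_imp_deriv)
qed

lemma curve_deriv_chain:
  assumes "finite J" "\<exists>G. curve_deriv J F p G" "c s = p"
    "\<And>j. j \<in> J \<Longrightarrow> ((\<lambda>u. c u j) has_real_derivative c' j) (at s)"
  shows "((\<lambda>u. F (c u)) has_real_derivative (\<Sum>j\<in>J. partial j F p * c' j)) (at s)"
proof -
  obtain G where G: "curve_deriv J F p G" using assms(2) by blast
  then have "((\<lambda>u. F (c u)) has_real_derivative (\<Sum>j\<in>J. G j * c' j)) (at s)"
    using assms(3,4) unfolding curve_deriv_def by blast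
  then show ?thesis using curve_deriv_partial(2)[OF assms(1) G] by simp
qed

section \<open>The Cholesky chart\<close>

text \<open>Total in the indices, so that the sums handed to \<open>schur\<close> need no matrix
  dimensions.\<close>

definition tri_entry :: "(nat \<times> nat \<Rightarrow> real) \<Rightarrow> nat \<Rightarrow> nat \<Rightarrow> real" where
  "tri_entry t k j = (if k \<le> j then t (k, j) else 0)"

lemma tri_mat_carrier [simp]: "tri_mat d t \<in> carrier_mat d d"
  by (simp add: tri_mat_def)

lemma dim_tri_mat [simp]: "dim_row (tri_mat d t) = d" "dim_col (tri_mat d t) = d"
  by (simp_all add: tri_mat_def)

lemma shifted_gram_carrier: "T \<in> carrier_mat d d \<Longrightarrow> shifted_gram d \<gamma> T \<in> carrier_mat d d"
  by (auto simp: shifted_gram_def)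

lemma tri_mat_index: "k < d \<Longrightarrow> j < d \<Longrightarrow> tri_mat d t $$ (k, j) = tri_entry t k j"
  by (simp add: tri_mat_def tri_entry_def)

lemma upper_triangular_tri_mat: "upper_triangular (tri_mat d t)"
  by (auto simp: upper_triangular_def tri_mat_def)

lemma det_tri_mat: "Determinant.det (tri_mat d t) = (\<Prod>i<d. t (i, i))"
proof -
  have "Determinant.det (tri_mat d t) = (\<Prod>i=0..<d. tri_mat d t $$ (i, i))"
    using det_upper_triangular[OF upper_triangular_tri_mat tri_mat_carrier, of d t]
    by (simp add: prod_list_diag_prod tri_mat_def)
  also have "\<dots> = (\<Prod>i<d. t (i, i))"
    by (intro prod.cong) (auto simp: tri_mat_def)
  finally show ?thesis .
qed

lemma transpose_mult_index:
  assumes "(L :: real mat) \<in> carrier_mat d d" "j < d" "l < d"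
  shows "(transpose_mat L * L) $$ (j, l) = (\<Sum>k<d. L $$ (k, j) * L $$ (k, l))"
  using assms by (simp add: scalar_prod_def atLeast0LessThan)

lemma det_chol:
  assumes "L \<in> carrier_mat d d"
  shows "Determinant.det (chol L) = (Determinant.det L)\<^sup>2"
  using assms by (simp add: chol_def det_mult[of _ d] det_transpose power2_eq_square)

lemma chol_entry_chol:
  assumes "L \<in> carrier_mat d d" "upper_triangular L" "\<And>i. i < d \<Longrightarrow> L $$ (i, i) > 0"
    and "i < d" "j < d"
  shows "chol_entry (\<lambda>j l. chol L $$ (j, l)) i j = L $$ (i, j)"
  by (rule chol_entry_of_gram[where T = "\<lambda>m j. L $$ (m, j)"])
    (use assms in \<open>auto simp: chol_def transpose_mult_index upper_triangular_def
      simp del: index_mult_mat(1)\<close>)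

text \<open>Both sides are \<open>\<bar>T a\<bar>\<^sup>2\<close>. It serves the positivity of the
  form of \<open>F_entry\<close> and the bound for lattice vectors.\<close>

lemma gram_form:
  fixes T :: "nat \<Rightarrow> nat \<Rightarrow> real"
  shows "(\<Sum>j<d. \<Sum>l<d. a j * a l * (\<Sum>k<d. T k j * T k l)) = (\<Sum>k<d. (\<Sum>j<d. T k j * a j)\<^sup>2)"
proof -
  have "(\<Sum>k<d. (\<Sum>j<d. T k j * a j)\<^sup>2) =
      (\<Sum>k<d. \<Sum>j<d. \<Sum>l<d. (T k j * a j) * (T k l * a l))"
    by (simp add: power2_eq_square sum_product)
  also have "\<dots> = (\<Sum>j<d. \<Sum>k<d. \<Sum>l<d. (T k j * a j) * (T k l * a l))"
    by (rule sum.swap)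
  also have "\<dots> = (\<Sum>j<d. \<Sum>l<d. \<Sum>k<d. (T k j * a j) * (T k l * a l))"
    by (intro sum.cong refl sum.swap)
  also have "\<dots> = (\<Sum>j<d. \<Sum>l<d. a j * a l * (\<Sum>k<d. T k j * T k l))"
    by (simp add: sum_distrib_left mult_ac)
  finally show ?thesis ..
qed

lemma inj_on_chol: "inj_on chol (Theta_pp d)"
proof (rule inj_onI)
  fix L L' assume L: "L \<in> Theta_pp d" and L': "L' \<in> Theta_pp d" and eq: "chol L = chol L'"
  have "L $$ (i, j) = L' $$ (i, j)" if "i < d" "j < d" for i j
    using chol_entry_chol[of L d i j] chol_entry_chol[of L' d i j] L L' that eq
    by (simp add: Theta_pp_def)
  then show "L = L'" using L L' by (auto simp: Theta_pp_def)
qed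

definition theta_ext :: "nat \<Rightarrow> (nat \<times> nat \<Rightarrow> real) \<Rightarrow> nat \<times> nat \<Rightarrow> real" where
  "theta_ext d x = x((d - 1, d - 1) := 1 / (\<Prod>i<d - 1. x (i, i)))"

lemma theta_mat_eq: "theta_mat d x = tri_mat d (theta_ext d x)"
  by (simp add: theta_mat_def theta_ext_def)

section \<open>The two matrices in coordinates, and their Cholesky factors\<close>

locale hypersurface =
  fixes d :: nat and \<gamma> c0 :: real
  assumes d2: "d \<ge> 2" and gam: "\<gamma> > 0" and c0: "c0 > 0"
begin

definition c :: real where "c = c0 powr (- 1 / real d)"

definition F_entry :: "(nat \<times> nat \<Rightarrow> real) \<Rightarrow> nat \<Rightarrow> nat \<Rightarrow> real" where
  "F_entry t j l = c * ((if j = l then \<gamma> else 0) + (\<Sum>k<d. tri_entry t k j * tri_entry t k l))"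

text \<open>Entries of \<open>L\<^sup>T L / c - \<gamma> I\<close>, the matrix that has to equal
  \<open>H\<^sup>T H\<close>.\<close>

definition Q_entry :: "(nat \<times> nat \<Rightarrow> real) \<Rightarrow> nat \<Rightarrow> nat \<Rightarrow> real" where
  "Q_entry x j l =
     (\<Sum>k<d. tri_entry (theta_ext d x) k j * tri_entry (theta_ext d x) k l) / c
     - (if j = l then \<gamma> else 0)"

text \<open>Positive pivots make \<open>Q_entry x\<close> positive definite, so that it has a
  Cholesky factor. The set is \<open>N_star\<close> in coordinates, see
  \<open>theta_mat_N_star_iff\<close>; the nested comprehension has the shape of
  \<open>openin_schur_pos\<close>.\<close>

definition chart_dom :: "(nat \<times> nat \<Rightarrow> real) set" where
  "chart_dom = {x \<in> {x \<in> theta_idx d \<rightarrow>\<^sub>E UNIV. \<forall>i<d - 1. x (i, i) > 0}.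
     \<forall>k<d. schur (Q_entry x) k k k > 0}"

definition chart :: "(nat \<times> nat \<Rightarrow> real) \<Rightarrow> nat \<times> nat \<Rightarrow> real" where
  "chart x = (\<lambda>(i, j)\<in>tri_idx d. chol_entry (Q_entry x) i j)"

lemma c_pos: "c > 0" using c0 by (simp add: c_def)

lemma c_power: "c ^ d = 1 / c0"
proof -
  have "c ^ d = c0 powr (real d * (- 1 / real d))"
    using c0 by (simp add: c_def powr_power)
  also have "real d * (- 1 / real d) = - 1" using d2 by simp
  finally show ?thesis using c0 by (simp add: powr_minus_divide)
qed

lemma F_entry_sym: "F_entry t j l = F_entry t l j"
  by (simp add: F_entry_def mult.commute)

lemma Q_entry_sym: "Q_entry x j l = Q_entry x l j"
  by (simp add: Q_entry_def mult.commute)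

lemma f_map_eq: "f_map d \<gamma> c0 t = c \<cdot>\<^sub>m shifted_gram d \<gamma> (tri_mat d t)"
  by (simp add: f_map_def c_def)

lemma f_map_carrier: "f_map d \<gamma> c0 t \<in> carrier_mat d d"
  by (simp add: f_map_def shifted_gram_carrier)

lemma f_map_index:
  assumes "j < d" "l < d"
  shows "f_map d \<gamma> c0 t $$ (j, l) = F_entry t j l"
  using assms transpose_mult_index[OF tri_mat_carrier assms, of t]
  by (simp add: f_map_eq shifted_gram_def F_entry_def tri_mat_index
    del: index_mult_mat(1))

lemma g_map_eq: "g_map d \<gamma> c0 t = Determinant.det (shifted_gram d \<gamma> (tri_mat d t)) / c0"
proof -
  have "shifted_gram d \<gamma> (tri_mat d t) \<in> carrier_mat d d" by (simp add: shifted_gram_carrier)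
  then show ?thesis by (simp add: g_map_def f_map_eq c_power)
qed

lemma M_tilde_iff: "t \<in> M_tilde d \<gamma> c0 \<longleftrightarrow> t \<in> tri_nonneg d \<and> g_map d \<gamma> c0 t = 1"
  using c0 by (auto simp: M_tilde_def g_map_eq)

text \<open>A triangular matrix has full rank exactly when no diagonal entry vanishes, and on
  \<open>M_tilde\<close> the diagonal is non-negative.\<close>

lemma M_star_iff: "t \<in> M_star d \<gamma> c0 \<longleftrightarrow> t \<in> M_tilde d \<gamma> c0 \<and> (\<forall>i<d. t (i, i) > 0)"
proof -
  have "vec_space.rank d (tri_mat d t) = d \<longleftrightarrow> (\<forall>i<d. t (i, i) \<noteq> 0)"
    using vec_space.det_rank_iff[OF tri_mat_carrier, of d t] by (auto simp: det_tri_mat)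
  then show ?thesis
    by (fastforce simp: M_star_def M_tilde_def tri_nonneg_def less_eq_real_def)
qed

text \<open>The first summand makes the form positive definite and later bounds the integer vectors
  on which it is small.\<close>

lemma F_entry_form:
  "(\<Sum>j<d. \<Sum>l<d. a j * a l * F_entry t j l) =
     c * \<gamma> * (\<Sum>j<d. (a j)\<^sup>2) + c * (\<Sum>k<d. (\<Sum>j<d. tri_entry t k j * a j)\<^sup>2)"
proof -
  have 1: "(\<Sum>j<d. \<Sum>l<d. a j * a l * (if j = l then \<gamma> else 0)) = \<gamma> * (\<Sum>j<d. (a j)\<^sup>2)"
  proof -
    have "(\<Sum>l<d. a j * a l * (if j = l then \<gamma> else 0)) = \<gamma> * (a j)\<^sup>2" if "j < d" for j
      using that by (simp add: if_distrib[of "\<lambda>u. _ * u"] power2_eq_square cong: if_cong)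
    then show ?thesis by (simp add: sum_distrib_left)
  qed
  have "(\<Sum>j<d. \<Sum>l<d. a j * a l * F_entry t j l) =
      c * ((\<Sum>j<d. \<Sum>l<d. a j * a l * (if j = l then \<gamma> else 0)) +
        (\<Sum>j<d. \<Sum>l<d. a j * a l * (\<Sum>k<d. tri_entry t k j * tri_entry t k l)))"
    unfolding sum.distrib[symmetric] sum_distrib_left[of c] F_entry_def
    by (intro sum.cong refl) (simp only: distrib_left mult_ac)
  then show ?thesis unfolding 1 gram_form by (simp add: distrib_left mult.assoc)
qed

lemma F_entry_pd:
  assumes "\<exists>j<d. a j \<noteq> 0"
  shows "(\<Sum>j<d. \<Sum>l<d. a j * a l * F_entry t j l) > 0"
proof -
  obtain j where "j < d" "a j \<noteq> 0" using assms by blast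
  then have "(\<Sum>j<d. (a j)\<^sup>2) > 0" by (intro sum_pos2[of _ j]) auto
  moreover have "(\<Sum>k<d. (\<Sum>j<d. tri_entry t k j * a j)\<^sup>2) \<ge> 0" by (simp add: sum_nonneg)
  ultimately show ?thesis unfolding F_entry_form
    using c_pos gam by (intro add_pos_nonneg mult_pos_pos mult_nonneg_nonneg) auto
qed

lemma schur_F_pos: "k < d \<Longrightarrow> schur (F_entry t) k k k > 0"
  by (rule schur_pos[of _ d]) (use F_entry_sym F_entry_pd in auto)

lemma schur_F_ne: "k < d \<Longrightarrow> schur (F_entry t) k k k \<noteq> 0"
  using schur_F_pos[of k t] by simp

text \<open>An explicit preimage of \<open>f_map d \<gamma> c0 t\<close> under \<open>chol\<close>.
  \<open>N_star\<close> is defined through \<open>inv_into\<close>, which can be evaluated only on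
  the image of \<open>chol\<close>.\<close>

definition chol_F :: "(nat \<times> nat \<Rightarrow> real) \<Rightarrow> real mat" where
  "chol_F t = mat d d (\<lambda>(i, j). chol_entry (F_entry t) i j)"

lemma chol_chol_F: "chol (chol_F t) = f_map d \<gamma> c0 t"
proof (rule eq_matI)
  fix j l assume "j < dim_row (f_map d \<gamma> c0 t)" "l < dim_col (f_map d \<gamma> c0 t)"
  then have jl: "j < d" "l < d" using f_map_carrier[of t] by auto
  have "chol (chol_F t) $$ (j, l) =
      (\<Sum>k<d. chol_entry (F_entry t) k j * chol_entry (F_entry t) k l)"
    unfolding chol_def
    by (subst transpose_mult_index[of _ d]) (use jl in \<open>auto simp: chol_F_def\<close>)
  also have "\<dots> = F_entry t j l"
    by (rule chol_entry_gram[symmetric]) (use jl schur_F_pos F_entry_sym in auto)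
  finally show "chol (chol_F t) $$ (j, l) = f_map d \<gamma> c0 t $$ (j, l)"
    using jl by (simp add: f_map_index)
qed (use f_map_carrier[of t] in \<open>auto simp: chol_def chol_F_def\<close>)

lemma chol_F_diag: "i < d \<Longrightarrow> chol_F t $$ (i, i) = sqrt (schur (F_entry t) i i i)"
  using schur_F_pos[of i t] by (simp add: chol_F_def chol_entry_diag)

lemma upper_triangular_chol_F: "upper_triangular (chol_F t)"
proof -
  have "chol_entry (F_entry t) i j = 0" if "j < i" "i < d" for i j
    by (rule chol_entry_eq_0[OF F_entry_sym schur_F_ne]) (use that in auto)
  then show ?thesis by (auto simp: upper_triangular_def chol_F_def)
qed

lemma det_chol_F: "Determinant.det (chol_F t) = (\<Prod>k<d. sqrt (schur (F_entry t) k k k))"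
proof -
  have "Determinant.det (chol_F t) = (\<Prod>k=0..<d. chol_F t $$ (k, k))"
    using det_upper_triangular[OF upper_triangular_chol_F, of t d]
    by (simp add: chol_F_def prod_list_diag_prod)
  also have "\<dots> = (\<Prod>k<d. sqrt (schur (F_entry t) k k k))"
    by (intro prod.cong) (auto simp: chol_F_diag)
  finally show ?thesis .
qed

text \<open>The Cholesky factor has the square roots of the pivots on its diagonal, and
  \<open>det (L\<^sup>T L) = (det L)\<^sup>2\<close>.\<close>

lemma g_map_schur: "g_map d \<gamma> c0 t = (\<Prod>k<d. schur (F_entry t) k k k)"
proof -
  have "g_map d \<gamma> c0 t = (\<Prod>k<d. sqrt (schur (F_entry t) k k k))\<^sup>2"
    unfolding g_map_def chol_chol_F[symmetric]
    by (subst det_chol[of _ d]) (simp_all add: chol_F_def[abs_def] det_chol_F[unfolded chol_F_def])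
  also have "\<dots> = (\<Prod>k<d. schur (F_entry t) k k k)"
    unfolding prod_power_distrib
    by (rule prod.cong) (simp_all add: schur_F_pos less_imp_le)
  finally show ?thesis .
qed

lemma chol_F_Theta:
  assumes "t \<in> M_star d \<gamma> c0"
  shows "chol_F t \<in> Theta_pp d"
proof -
  have "(Determinant.det (chol_F t))\<^sup>2 = 1"
    using assms det_chol[of "chol_F t" d]
    by (simp add: M_star_iff M_tilde_iff g_map_def chol_chol_F chol_F_def[of t, symmetric])
      (simp add: chol_F_def)
  moreover have "Determinant.det (chol_F t) > 0"
    unfolding det_chol_F by (rule prod_pos) (simp add: schur_F_pos)
  ultimately have "Determinant.det (chol_F t) = 1"
    by (simp add: power2_eq_1_iff)
  then show ?thesis
    by (auto simp: Theta_pp_def upper_triangular_chol_F chol_F_diag schur_F_pos)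
      (simp add: chol_F_def)
qed

section \<open>The chart and the sets \<open>M_star\<close> and \<open>N_star\<close>\<close>

lemma theta_ext_diag_pos:
  assumes "\<And>i. i < d - 1 \<Longrightarrow> x (i, i) > 0" "i < d"
  shows "theta_ext d x (i, i) > 0"
proof (cases "i < d - 1")
  case False
  then have "i = d - 1" using assms(2) by simp
  then show ?thesis using assms(1) by (auto simp: theta_ext_def intro!: prod_pos)
qed (use assms in \<open>simp add: theta_ext_def\<close>)

lemma theta_mat_Theta:
  assumes "\<And>i. i < d - 1 \<Longrightarrow> x (i, i) > 0"
  shows "theta_mat d x \<in> Theta_pp d"
proof -
  have "(\<Prod>i<d. theta_ext d x (i, i)) = (\<Prod>i<d - 1. theta_ext d x (i, i)) * theta_ext d x (d - 1, d - 1)"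
    using d2 prod.lessThan_Suc[of "\<lambda>i. theta_ext d x (i, i)" "d - 1"] by simp
  also have "(\<Prod>i<d - 1. theta_ext d x (i, i)) = (\<Prod>i<d - 1. x (i, i))"
    by (rule prod.cong) (auto simp: theta_ext_def)
  also have "\<dots> * theta_ext d x (d - 1, d - 1) = 1"
    using assms by (force simp: theta_ext_def)
  finally show ?thesis
    using theta_ext_diag_pos[of x, OF assms]
    by (auto simp: Theta_pp_def theta_mat_eq upper_triangular_tri_mat det_tri_mat tri_mat_index
      tri_entry_def)
qed

lemma chol_theta_mat_index:
  assumes "j < d" "l < d"
  shows "chol (theta_mat d x) $$ (j, l) = c * (Q_entry x j l + (if j = l then \<gamma> else 0))"
  unfolding chol_def theta_mat_eq using c_pos assms
  by (subst transpose_mult_index[of _ d]) (auto simp: tri_mat_index Q_entry_def)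

lemma chart_dom_pos:
  assumes "x \<in> chart_dom"
  shows "i < d - 1 \<Longrightarrow> x (i, i) > 0" "k < d \<Longrightarrow> schur (Q_entry x) k k k > 0"
  using assms by (auto simp: chart_dom_def)

lemma chart_entry: "i \<le> j \<Longrightarrow> j < d \<Longrightarrow> chart x (i, j) = chol_entry (Q_entry x) i j"
  by (simp add: chart_def tri_idx_def)

lemma chart_diag: "x \<in> chart_dom \<Longrightarrow> i < d \<Longrightarrow> chart x (i, i) = sqrt (schur (Q_entry x) i i i)"
  using chart_dom_pos(2) by (simp add: chart_entry chol_entry_diag)

lemma chart_diag_pos: "x \<in> chart_dom \<Longrightarrow> i < d \<Longrightarrow> chart x (i, i) > 0"
  using chart_dom_pos(2) by (simp add: chart_diag)

lemma tri_entry_chart: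
  assumes "x \<in> chart_dom" "k < d" "j < d"
  shows "tri_entry (chart x) k j = chol_entry (Q_entry x) k j"
proof (cases "k \<le> j")
  case False
  have "chol_entry (Q_entry x) k j = 0"
  proof (rule chol_entry_eq_0[OF Q_entry_sym])
    show "schur (Q_entry x) m m m \<noteq> 0" if "m < k" for m
      using chart_dom_pos(2)[OF assms(1), of m] that assms(2) by simp
  qed (use False in simp)
  then show ?thesis using False by (simp add: tri_entry_def)
qed (use assms in \<open>simp add: tri_entry_def chart_entry\<close>)

text \<open>By construction the chart satisfies \<open>H\<^sup>T H = Q\<close>, which is this
  equation solved for \<open>H\<^sup>T H\<close>.\<close>

lemma f_map_chart:
  assumes "x \<in> chart_dom"
  shows "f_map d \<gamma> c0 (chart x) = chol (theta_mat d x)"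
proof (rule eq_matI)
  fix j l assume "j < dim_row (chol (theta_mat d x))" "l < dim_col (chol (theta_mat d x))"
  then have jl: "j < d" "l < d" by (auto simp: chol_def theta_mat_eq tri_mat_def)
  have "Q_entry x j l = (\<Sum>m<d. chol_entry (Q_entry x) m j * chol_entry (Q_entry x) m l)"
    by (rule chol_entry_gram) (use jl Q_entry_sym chart_dom_pos(2)[OF assms] in auto)
  also have "\<dots> = (\<Sum>m<d. tri_entry (chart x) m j * tri_entry (chart x) m l)"
    using assms jl by (simp add: tri_entry_chart)
  finally show "f_map d \<gamma> c0 (chart x) $$ (j, l) = chol (theta_mat d x) $$ (j, l)"
    using jl by (simp add: f_map_index chol_theta_mat_index F_entry_def add.commute)
qed (use f_map_carrier[of "chart x"] in \<open>auto simp: chol_def theta_mat_eq\<close>)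

lemma chart_M_star:
  assumes "x \<in> chart_dom"
  shows "chart x \<in> M_star d \<gamma> c0"
proof -
  have "theta_mat d x \<in> Theta_pp d"
    using chart_dom_pos(1)[OF assms] by (rule theta_mat_Theta)
  then have "g_map d \<gamma> c0 (chart x) = 1"
    by (simp add: g_map_def f_map_chart[OF assms] det_chol[of _ d] Theta_pp_def)
  moreover have "chart x \<in> tri_idx d \<rightarrow>\<^sub>E UNIV" by (simp add: chart_def)
  ultimately show ?thesis
    using chart_diag_pos[OF assms] by (auto simp: M_star_iff M_tilde_iff tri_nonneg_def less_imp_le)
qed

text \<open>The hypothesis says \<open>Q = H\<^sup>T H\<close>. Eliminating in this Gram matrix
  yields the pivots \<open>h_ii^2 > 0\<close>, so \<open>x\<close> lies in the domain, and the rows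
  of \<open>H\<close> as Cholesky rows.\<close>

lemma chol_eq_f_map_imp:
  assumes x: "x \<in> theta_idx d \<rightarrow>\<^sub>E UNIV" "theta_mat d x \<in> Theta_pp d"
    and H: "H \<in> M_star d \<gamma> c0" "chol (theta_mat d x) = f_map d \<gamma> c0 H"
  shows "x \<in> chart_dom" "H = chart x"
proof -
  have Hpos: "H (i, i) > 0" if "i < d" for i using H that by (simp add: M_star_iff)
  have Q: "Q_entry x j l = (\<Sum>m<d. tri_entry H m j * tri_entry H m l)" if "j < d" "l < d" for j l
  proof -
    have "c * (Q_entry x j l + (if j = l then \<gamma> else 0)) = F_entry H j l"
      using that H(2) by (simp add: chol_theta_mat_index[symmetric] f_map_index)
    then show ?thesis using c_pos by (auto simp: F_entry_def split: if_splits)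
  qed
  have *: "schur (Q_entry x) i i j = tri_entry H i i * tri_entry H i j" if "i < d" "j < d" for i j
    by (rule schur_row_of_gram[of d]) (use Q Hpos that in \<open>force simp: tri_entry_def\<close>)+
  have "x (i, i) > 0" if "i < d - 1" for i
  proof -
    have "theta_mat d x $$ (i, i) > 0" using x(2) that by (simp add: Theta_pp_def)
    then show ?thesis using that by (simp add: theta_mat_eq tri_mat_index tri_entry_def theta_ext_def)
  qed
  then show "x \<in> chart_dom"
    using x(1) * Hpos by (auto simp: chart_dom_def tri_entry_def)
  show "H = chart x"
  proof (rule extensionalityI)
    show "H \<in> extensional (tri_idx d)"
      using H by (auto simp: M_star_iff M_tilde_iff tri_nonneg_def PiE_iff)
    show "chart x \<in> extensional (tri_idx d)" by (simp add: chart_def)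
    fix b assume b: "b \<in> tri_idx d"
    obtain i j where ij: "b = (i, j)" by (cases b)
    then have "i \<le> j" "j < d" using b by (auto simp: tri_idx_def)
    then show "H b = chart x b"
      using *[of i j] *[of i i] Hpos[of i] ij
      by (simp add: chart_entry chol_entry_def tri_entry_def)
  qed
qed

text \<open>The \<open>inv_into\<close> is resolved by the existence of a Cholesky factor in one
  direction and by injectivity of \<open>chol\<close> in the other.\<close>

lemma theta_mat_N_star_iff:
  assumes "x \<in> theta_idx d \<rightarrow>\<^sub>E UNIV"
  shows "theta_mat d x \<in> N_star d \<gamma> c0 \<longleftrightarrow> x \<in> chart_dom"
proof
  assume "theta_mat d x \<in> N_star d \<gamma> c0"
  then obtain H where H: "H \<in> M_star d \<gamma> c0"
    "theta_mat d x = inv_into (Theta_pp d) chol (f_map d \<gamma> c0 H)"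
    by (auto simp: N_star_def)
  have f: "f_map d \<gamma> c0 H \<in> chol ` Theta_pp d"
    using chol_F_Theta[OF H(1)] chol_chol_F[of H] by (metis imageI)
  show "x \<in> chart_dom"
    by (rule chol_eq_f_map_imp(1)[OF assms _ H(1)])
      (use f H(2) in \<open>simp_all add: inv_into_into f_inv_into_f\<close>)
next
  assume x: "x \<in> chart_dom"
  have "theta_mat d x \<in> Theta_pp d"
    using chart_dom_pos(1)[OF x] by (rule theta_mat_Theta)
  then have "theta_mat d x = (inv_into (Theta_pp d) chol \<circ> f_map d \<gamma> c0) (chart x)"
    by (simp add: f_map_chart[OF x] inv_into_f_f inj_on_chol)
  then show "theta_mat d x \<in> N_star d \<gamma> c0"
    unfolding N_star_def using chart_M_star[OF x] by blast
qed

lemma H_of_theta_mat: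
  assumes "x \<in> chart_dom"
  shows "H_of d \<gamma> c0 (theta_mat d x) = chart x"
  unfolding H_of_def
proof (rule the_equality)
  show "chart x \<in> M_star d \<gamma> c0 \<and> chol (theta_mat d x) = f_map d \<gamma> c0 (chart x)"
    using chart_M_star f_map_chart assms by simp
  fix H assume "H \<in> M_star d \<gamma> c0 \<and> chol (theta_mat d x) = f_map d \<gamma> c0 H"
  then show "H = chart x"
    using chol_eq_f_map_imp(2)[of x H] theta_mat_Theta chart_dom_pos(1)[OF assms] assms
    by (simp add: chart_dom_def)
qed

section \<open>The Jacobian of the chart\<close>

text \<open>The last row of the triangle consists of the removed corner only, so removing it amounts
  to \<open>i < d - 1\<close>.\<close>

lemma theta_idx_iff: "(i, j) \<in> theta_idx d \<longleftrightarrow> i \<le> j \<and> j < d \<and> i < d - 1"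
  using d2 by (auto simp: theta_idx_def tri_idx_def)

lemma tri_idx_eq: "tri_idx d = insert (d - 1, d - 1) (theta_idx d)"
  using d2 by (auto simp: theta_idx_def tri_idx_def)

lemma finite_theta_idx: "finite (theta_idx d)"
  by (simp add: theta_idx_def finite_tri_idx)

text \<open>Encodes the lexicographic order of positions as a number, the form of rank that
  \<open>leibniz_gram_rank_one\<close> takes.\<close>

definition lex_rank :: "nat \<times> nat \<Rightarrow> nat" where
  "lex_rank = (\<lambda>(i, j). i * d + j)"

lemma lex_rank_less:
  assumes "j < d" "j' < d"
  shows "lex_rank (i, j) < lex_rank (i', j') \<longleftrightarrow> i < i' \<or> i = i' \<and> j < j'"
proof -
  have *: "m * d + j < m' * d + j'" if "m < m'" "j < d" for m m' j j'
  proof -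
    have "Suc m * d \<le> m' * d" using that(1) by (intro mult_le_mono1) simp
    then show ?thesis using that(2) by simp
  qed
  show ?thesis
    using *[of i i' j j'] *[of i' i j' j] assms
    by (cases i i' rule: linorder_cases) (auto simp: lex_rank_def)
qed

lemma inj_on_lex_rank: "inj_on lex_rank (theta_idx d)"
proof (rule inj_onI)
  fix a b assume ab: "a \<in> theta_idx d" "b \<in> theta_idx d" "lex_rank a = lex_rank b"
  obtain i j i' j' where "a = (i, j)" "b = (i', j')" by (metis surj_pair)
  then show "a = b"
    using ab lex_rank_less[of j j' i i'] lex_rank_less[of j' j i' i]
    by (auto simp: theta_idx_iff)
qed

text \<open>The entry at \<open>(p, q)\<close> involves only rows \<open>k \<le> p\<close> of
  \<open>L\<close>, so a change below row \<open>i\<close> is not seen; a change in row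
  \<open>i\<close> sits in column \<open>a2\<close>, to the right of \<open>p\<close> and
  \<open>q\<close>. The forced last diagonal entry may change as well, but it lies in row
  \<open>d - 1 > i\<close>.\<close>

lemma Q_entry_upd:
  assumes "i < d - 1" "i \<le> j" "i < a1 \<or> i = a1 \<and> j < a2" "p \<le> i" "q \<le> i \<or> q = j"
  shows "Q_entry (x((a1, a2) := s)) p q = Q_entry x p q"
proof -
  have "tri_entry (theta_ext d (x((a1, a2) := s))) k p * tri_entry (theta_ext d (x((a1, a2) := s))) k q
      = tri_entry (theta_ext d x) k p * tri_entry (theta_ext d x) k q" for k
    using assms by (auto simp: tri_entry_def theta_ext_def)
  then show ?thesis by (simp add: Q_entry_def)
qed

lemma chol_entry_upd:
  assumes "i < d - 1" "i \<le> j" "i < a1 \<or> i = a1 \<and> j < a2"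
  shows "chol_entry (Q_entry (x((a1, a2) := s))) i j = chol_entry (Q_entry x) i j"
  by (rule chol_entry_cong) (rule Q_entry_upd[OF assms])

lemma schur_diag_upd:
  assumes "i < d - 1" "i < a1 \<or> i = a1 \<and> i < a2"
  shows "schur (Q_entry (x((a1, a2) := s))) i i i = schur (Q_entry x) i i i"
proof (rule schur_cong[of i "{..i}"])
  show "Q_entry (x((a1, a2) := s)) p q = Q_entry x p q" if "p \<le> i" "q \<in> {..i}" for p q
    by (rule Q_entry_upd[of i i]) (use assms that in auto)
qed auto

lemma chart_upd:
  assumes "a \<in> theta_idx d" "b \<in> theta_idx d" "lex_rank b < lex_rank a"
  shows "chart (x(a := s)) b = chart x b"
proof -
  obtain i j a1 a2 where ab: "b = (i, j)" "a = (a1, a2)" by (metis surj_pair)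
  with assms have "i \<le> j" "j < d" "i < d - 1" "i < a1 \<or> i = a1 \<and> j < a2"
    by (auto simp: theta_idx_iff lex_rank_less)
  then show ?thesis unfolding ab by (simp add: chart_entry chol_entry_upd)
qed

lemma partial_chart_eq_0:
  assumes "a \<in> theta_idx d" "b \<in> theta_idx d" "lex_rank b < lex_rank a"
  shows "partial a (\<lambda>y. chart y b) x = 0"
  by (simp add: partial_def chart_upd[OF assms])

text \<open>Only the term \<open>k = i\<close> changes. The factor
  \<open>(x((i, j) := s)) (i, i)\<close> treats both cases at once: it is \<open>s\<close> if
  \<open>i = j\<close> and \<open>x (i, i)\<close> otherwise.\<close>

lemma Q_entry_row_upd:
  assumes "i \<le> j" "j < d" "i < d - 1"
  shows "Q_entry (x((i, j) := s)) i j =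
    Q_entry x i j + ((x((i, j) := s)) (i, i) * s - x (i, i) * x (i, j)) / c"
proof -
  define y where "y = x((i, j) := s)"
  define f where "f x k = tri_entry (theta_ext d x) k i * tri_entry (theta_ext d x) k j" for x k
  have "f y k - f x k = (if k = i then y (i, i) * s - x (i, i) * x (i, j) else 0)" for k
    using assms by (auto simp: f_def y_def tri_entry_def theta_ext_def)
  then have "(\<Sum>k<d. f y k - f x k) = y (i, i) * s - x (i, i) * x (i, j)"
    using assms by simp
  then have "(\<Sum>k<d. f y k) = (\<Sum>k<d. f x k) + (y (i, i) * s - x (i, i) * x (i, j))"
    by (simp add: sum_subtractf)
  then show ?thesis
    unfolding Q_entry_def f_def[symmetric] y_def[symmetric] by (simp add: add_divide_distrib)
qed

text \<open>The earlier rows of the factor do not depend on the entry at \<open>(i, j)\<close>, so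
  by \<open>schur_sum\<close> the change of \<open>Q_entry\<close> passes unaltered to the Schur
  complement.\<close>

lemma schur_row_upd:
  assumes "x \<in> chart_dom" "i \<le> j" "j < d" "i < d - 1"
  shows "schur (Q_entry (x((i, j) := s))) i i j =
    schur (Q_entry x) i i j + ((x((i, j) := s)) (i, i) * s - x (i, i) * x (i, j)) / c"
proof -
  define y where "y = x((i, j) := s)"
  have "schur (Q_entry x) m m m > 0" if "m < i" for m
    using chart_dom_pos(2)[OF assms(1)] that assms by simp
  moreover have "schur (Q_entry y) m m m = schur (Q_entry x) m m m" if "m < i" for m
    unfolding y_def by (rule schur_diag_upd) (use that assms in auto)
  moreover have "chol_entry (Q_entry y) m q = chol_entry (Q_entry x) m q" if "m < i" "q \<in> {i, j}" for m q
    unfolding y_def by (rule chol_entry_upd) (use that assms in auto)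
  ultimately show ?thesis
    using schur_sum[of i "Q_entry x" i j] schur_sum[of i "Q_entry y" i j]
      Q_entry_row_upd[OF assms(2-), of x s]
    by (simp add: y_def[symmetric])
qed

text \<open>Off the diagonal the pivot is constant and \<open>h_ij\<close> is affine in
  \<open>l_ij\<close>. On the diagonal \<open>h_ii\<close> is the square root of a pivot quadratic
  in \<open>l_ii\<close>. Both derivatives come out the same.\<close>

lemma partial_chart_diag:
  assumes x: "x \<in> chart_dom" and ij: "(i, j) \<in> theta_idx d"
  shows "partial (i, j) (\<lambda>y. chart y (i, j)) x = x (i, i) / (c * chart x (i, i))"
proof -
  define S where "S = schur (Q_entry x) i i i"
  have ij': "i \<le> j" "j < d" "i < d - 1" using ij by (auto simp: theta_idx_iff)
  have S: "S > 0" "chart x (i, i) = sqrt S"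
    using chart_dom_pos(2)[OF x, of i] chart_diag[OF x, of i] ij' by (auto simp: S_def)
  have chart: "chart (x((i, j) := s)) (i, j) =
      (schur (Q_entry x) i i j + ((x((i, j) := s)) (i, i) * s - x (i, i) * x (i, j)) / c)
      / sqrt (schur (Q_entry (x((i, j) := s))) i i i)" for s
    using ij' schur_row_upd[OF x ij', of s] by (simp add: chart_entry chol_entry_def)
  have "((\<lambda>s. chart (x((i, j) := s)) (i, j)) has_real_derivative x (i, i) / (c * sqrt S))
      (at (x (i, j)))"
  proof (cases "i = j")
    case True
    \<comment> \<open>The square root appears as \<open>u / sqrt u\<close>, the shape of
      \<open>chol_entry\<close> on the diagonal.\<close>
    have "((\<lambda>s. (S + (s * s - x (i, i) * x (i, i)) / c) / sqrt (S + (s * s - x (i, i) * x (i, i)) / c))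
        has_real_derivative x (i, i) / (c * sqrt S)) (at (x (i, i)))"
      using S c_pos
      by (auto intro!: derivative_eq_intros simp: field_simps)
    then show ?thesis
      unfolding chart using True schur_row_upd[OF x ij'] by (simp add: S_def)
  next
    case False
    have "((\<lambda>s. (schur (Q_entry x) i i j + (x (i, i) * s - x (i, i) * x (i, j)) / c) / sqrt S)
        has_real_derivative x (i, i) / (c * sqrt S)) (at (x (i, j)))"
      using S c_pos by (auto intro!: derivative_eq_intros simp: field_simps)
    then show ?thesis
      unfolding chart using False ij' by (simp add: schur_diag_upd S_def)
  qed
  then show ?thesis
    unfolding partial_def S(2) by (rule DERIV_imp_deriv)
qed

section \<open>Open domain, regularity and injectivity of the chart\<close>

lemma openin_theta_pos:
  "openin (top_of_set (theta_idx d \<rightarrow>\<^sub>E UNIV))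
     {x \<in> theta_idx d \<rightarrow>\<^sub>E UNIV. \<forall>i<n. x (i, i) > (0 :: real)}"
proof (induction n)
  case (Suc n)
  have "{x \<in> theta_idx d \<rightarrow>\<^sub>E UNIV. \<forall>i<Suc n. x (i, i) > (0 :: real)} =
      {x \<in> {x \<in> theta_idx d \<rightarrow>\<^sub>E UNIV. \<forall>i<n. x (i, i) > (0 :: real)}. x (n, n) > 0}"
    by (auto simp: less_Suc_eq)
  then show ?case
    using openin_Collect_pos[OF Suc C1_on_continuous[OF C1_on_coord]] by simp
qed simp

lemma C1_on_Q_entry:
  assumes "\<And>x i. x \<in> V \<Longrightarrow> i < d - 1 \<Longrightarrow> x (i, i) > 0"
  shows "C1_on K V (\<lambda>x. Q_entry x j l)"
proof -
  have "C1_on K V (\<lambda>x. theta_ext d x b)" for b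
  proof (cases "b = (d - 1, d - 1)")
    case True
    have "C1_on K V (\<lambda>x. 1 / (\<Prod>i<d - 1. x (i, i)))"
      by (intro C1_on_divide C1_on_prod C1_on_const C1_on_coord) (use assms in force)
    then show ?thesis using True by (simp add: theta_ext_def)
  qed (simp add: theta_ext_def C1_on_coord)
  then have "C1_on K V (\<lambda>x. tri_entry (theta_ext d x) k i)" for k i
    by (cases "k \<le> i") (simp_all add: tri_entry_def C1_on_const)
  then show ?thesis
    unfolding Q_entry_def using c_pos
    by (intro C1_on_diff C1_on_divide C1_on_sum C1_on_mult C1_on_const) auto
qed

lemma openin_chart_dom: "openin (top_of_set (theta_idx d \<rightarrow>\<^sub>E UNIV)) chart_dom"
  unfolding chart_dom_def
  by (rule openin_schur_pos[OF C1_on_Q_entry openin_theta_pos]) auto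

lemma C1_on_chart:
  assumes "b \<in> tri_idx d"
  shows "C1_on K chart_dom (\<lambda>x. chart x b)"
proof -
  obtain i j where ij: "b = (i, j)" "i \<le> j" "j < d" using assms by (auto simp: tri_idx_def)
  have "C1_on K chart_dom (\<lambda>x. chol_entry (Q_entry x) i j)"
    by (rule C1_on_chol_entry[OF C1_on_Q_entry]) (use chart_dom_pos ij in auto)
  then show ?thesis using ij by (simp add: chart_entry)
qed

lemma continuous_on_chart: "continuous_on chart_dom chart"
proof (rule continuous_on_coordinatewise_then_product)
  fix b show "continuous_on chart_dom (\<lambda>x. chart x b)"
  proof (cases "b \<in> tri_idx d")
    case False
    then have "chart x b = undefined" for x by (simp add: chart_def)
    then show ?thesis by simp
  qed (rule C1_on_continuous[OF C1_on_chart])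
qed

text \<open>By \<open>f_map_chart\<close> the chart determines \<open>chol (theta_mat d x)\<close>,
  and both \<open>chol\<close> on \<open>Theta_pp d\<close> and the passage from coordinates to
  matrices are injective.\<close>

lemma inj_on_chart: "inj_on chart chart_dom"
proof (rule inj_onI)
  fix x y assume xy: "x \<in> chart_dom" "y \<in> chart_dom" "chart x = chart y"
  have *: "theta_mat d x \<in> Theta_pp d" if "x \<in> chart_dom" for x
    using chart_dom_pos(1)[OF that] by (rule theta_mat_Theta)
  have "chol (theta_mat d x) = chol (theta_mat d y)"
    using f_map_chart[OF xy(1)] f_map_chart[OF xy(2)] xy(3) by simp
  then have eq: "theta_mat d x = theta_mat d y"
    using inj_on_chol[of d] * xy(1,2) by (auto dest: inj_onD)
  show "x = y"
  proof (rule extensionalityI)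
    fix b assume b: "b \<in> theta_idx d"
    obtain i j where ij: "b = (i, j)" by (cases b)
    have "theta_mat d x $$ (i, j) = theta_mat d y $$ (i, j)" using eq by simp
    then show "x b = y b"
      using b ij by (auto simp: theta_idx_iff theta_mat_eq tri_mat_index tri_entry_def theta_ext_def)
  qed (use xy in \<open>auto simp: chart_dom_def PiE_iff\<close>)
qed

section \<open>The gradient of \<open>g_map\<close>\<close>

lemma curve_deriv_F_entry:
  assumes "j < d" "l < d"
  shows "\<exists>G. curve_deriv (tri_idx d) (\<lambda>t. F_entry t j l) p G"
proof -
  have tri: "\<exists>G. curve_deriv (tri_idx d) (\<lambda>t. tri_entry t k j) p G" if "j < d" for k j
  proof (cases "k \<le> j")
    case True
    then have "(k, j) \<in> tri_idx d" using that by (simp add: tri_idx_def)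
    from curve_deriv_coord[OF finite_tri_idx this] show ?thesis
      using True by (auto simp: tri_entry_def)
  qed (auto simp: tri_entry_def intro: curve_deriv_const)
  have "\<exists>G. curve_deriv (tri_idx d) (\<lambda>t. \<Sum>k<d. tri_entry t k j * tri_entry t k l) p G"
    by (intro curve_deriv_sum curve_deriv_ex_mult tri assms)
  then show ?thesis unfolding F_entry_def
    by (intro curve_deriv_ex_add curve_deriv_ex_mult curve_deriv_ex_const)
qed

text \<open>The Leibniz formula exhibits \<open>g_map\<close> as a polynomial in the
  coordinates.\<close>

lemma curve_deriv_g_map: "\<exists>G. curve_deriv (tri_idx d) (g_map d \<gamma> c0) p G"
proof -
  have "g_map d \<gamma> c0 t =
      (\<Sum>\<pi> | \<pi> permutes {0..<d}. signof \<pi> * (\<Prod>i=0..<d. F_entry t i (\<pi> i)))" for t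
    unfolding g_map_def det_def'[OF f_map_carrier]
  proof (intro sum.cong refl arg_cong2[where f = "(*)"] prod.cong)
    fix \<pi> i assume "\<pi> \<in> {\<pi>. \<pi> permutes {0..<d}}" "i \<in> {0..<d}"
    then have "\<pi> i < d" "i < d" using permutes_in_image[of \<pi> "{0..<d}" i] by auto
    then show "f_map d \<gamma> c0 t $$ (i, \<pi> i) = F_entry t i (\<pi> i)" by (simp add: f_map_index)
  qed
  then have "g_map d \<gamma> c0 =
      (\<lambda>t. \<Sum>\<pi> | \<pi> permutes {0..<d}. signof \<pi> * (\<Prod>i=0..<d. F_entry t i (\<pi> i)))"
    by (rule ext)
  moreover have "\<exists>G. curve_deriv (tri_idx d) (\<lambda>t. signof \<pi> * (\<Prod>i=0..<d. F_entry t i (\<pi> i))) p G"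
    if "\<pi> permutes {0..<d}" for \<pi>
  proof -
    have "\<exists>G. curve_deriv (tri_idx d) (\<lambda>t. \<Prod>i=0..<d. F_entry t i (\<pi> i)) p G"
      by (rule curve_deriv_prod, rule curve_deriv_F_entry)
        (use permutes_in_image[OF that] in auto)
    then show ?thesis by (intro curve_deriv_ex_mult curve_deriv_ex_const)
  qed
  ultimately show ?thesis by (auto intro!: curve_deriv_sum)
qed

text \<open>In the product of pivots, only the last one depends on the last diagonal entry.\<close>

lemma partial_g_map_last:
  assumes "t (d - 1, d - 1) > 0"
  shows "partial (d - 1, d - 1) (g_map d \<gamma> c0) t > 0"
proof -
  define n where "n = d - 1"
  define T where "T s = t((n, n) := s)" for s
  have n: "n < d" "\<And>k. k < n \<Longrightarrow> k < d" "{..<d} = insert n {..<n}" using d2 by (auto simp: n_def)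
  have F: "F_entry (T s) p q = F_entry t p q + (if p = n \<and> q = n then c * (s\<^sup>2 - (t (n, n))\<^sup>2) else 0)"
    if "p < d" "q < d" for p q s
  proof -
    have "(\<Sum>k<d. tri_entry (T s) k p * tri_entry (T s) k q) =
        (\<Sum>k<d. tri_entry t k p * tri_entry t k q
          + (if k = n then if p = n \<and> q = n then s\<^sup>2 - (t (n, n))\<^sup>2 else 0 else 0))"
      using that by (intro sum.cong) (auto simp: tri_entry_def T_def power2_eq_square n_def)
    then show ?thesis using n(1) by (simp add: F_entry_def sum.distrib distrib_left)
  qed
  have schur: "schur (F_entry (T s)) k k k = schur (F_entry t) k k k" if "k < n" for k s
    by (rule schur_cong[of k "{..k}"]) (use that n F in auto)
  have ce: "chol_entry (F_entry (T s)) m n = chol_entry (F_entry t) m n" if "m < n" for m s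
    by (rule chol_entry_cong) (use that n F in auto)
  \<comment> \<open>By \<open>schur_sum\<close> the last pivot is the corner entry minus squares of
    entries of earlier rows, and \<open>ce\<close> shows these to be constant in
    \<open>s\<close>.\<close>
  have last: "schur (F_entry (T s)) n n n = schur (F_entry t) n n n + c * (s\<^sup>2 - (t (n, n))\<^sup>2)" for s
    using schur_sum[of n "F_entry (T s)" n n] schur_sum[of n "F_entry t" n n] schur_F_pos F[of n n s] n
    by (simp add: ce)
  define Pi where "Pi = (\<Prod>k<n. schur (F_entry t) k k k)"
  have Pi: "Pi > 0" unfolding Pi_def by (rule prod_pos) (use n schur_F_pos in auto)
  have "g_map d \<gamma> c0 (T s) = Pi * (schur (F_entry t) n n n + c * (s\<^sup>2 - (t (n, n))\<^sup>2))" for s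
    unfolding g_map_schur Pi_def n(3) by (simp add: schur last)
  moreover have "((\<lambda>s. Pi * (schur (F_entry t) n n n + c * (s\<^sup>2 - (t (n, n))\<^sup>2)))
      has_real_derivative Pi * (c * (2 * t (n, n)))) (at (t (n, n)))"
    by (auto intro!: derivative_eq_intros)
  ultimately have "partial (n, n) (g_map d \<gamma> c0) t = Pi * (c * (2 * t (n, n)))"
    unfolding partial_def T_def by (simp add: DERIV_imp_deriv)
  then show ?thesis using Pi c_pos assms by (simp add: n_def)
qed

text \<open>Along the chart \<open>g_map\<close> is constantly \<open>1\<close>, also at nearby
  points of the coordinate line because the domain is open. The chain rule computes the same
  derivative as the sum.\<close>

lemma gradient_tangent:
  assumes x: "x \<in> chart_dom" and a: "a \<in> theta_idx d"
  shows "(\<Sum>j\<in>tri_idx d. partial j (g_map d \<gamma> c0) (chart x) * partial a (\<lambda>y. chart y j) x) = 0"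
proof -
  have "((\<lambda>s. g_map d \<gamma> c0 (chart (x(a := s)))) has_real_derivative
      (\<Sum>j\<in>tri_idx d. partial j (g_map d \<gamma> c0) (chart x) * partial a (\<lambda>y. chart y j) x)) (at (x a))"
    by (rule curve_deriv_chain[OF finite_tri_idx curve_deriv_g_map])
      (use C1_on_partial[OF C1_on_chart a x] in simp_all)
  moreover have "((\<lambda>s. g_map d \<gamma> c0 (chart (x(a := s)))) has_real_derivative 0) (at (x a))"
  proof -
    have "eventually (\<lambda>s. g_map d \<gamma> c0 (chart (x(a := s))) = 1) (nhds (x a))"
      using eventually_fun_upd_in_openin[OF openin_chart_dom x a]
      by eventually_elim (use chart_M_star in \<open>auto simp: M_star_iff M_tilde_iff\<close>)
    then show ?thesis by (subst DERIV_cong_ev[OF refl _ refl]) auto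
  qed
  ultimately show ?thesis by (rule DERIV_unique)
qed

section \<open>The Gram determinant as the square of the density\<close>

lemma gram_det_chart:
  assumes x: "x \<in> chart_dom"
  shows "gram_det (theta_idx d) (tri_idx d) chart x =
    (\<Prod>(i, j)\<in>theta_idx d. x (i, i) / (c * chart x (i, i)))\<^sup>2 *
    (1 + (\<Sum>b\<in>theta_idx d. (partial b (g_map d \<gamma> c0) (chart x) /
       partial (d - 1, d - 1) (g_map d \<gamma> c0) (chart x))\<^sup>2))"
proof -
  define g where "g b = partial b (g_map d \<gamma> c0) (chart x)" for b
  define P where "P a b = partial a (\<lambda>y. chart y b) x" for a b
  define D where "D = (d - 1, d - 1)"
  have D: "D \<notin> theta_idx d" "tri_idx d = insert D (theta_idx d)"
    using tri_idx_eq by (auto simp: D_def theta_idx_iff)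
  have gD: "g D > 0"
    unfolding g_def D_def using chart_diag_pos[OF x] d2 by (intro partial_g_map_last) simp
  \<comment> \<open>The tangency relation solved for the derivative of the dependent coordinate
    \<open>D\<close>, after division by \<open>g D > 0\<close>.\<close>
  have w: "P a D = (\<Sum>j\<in>theta_idx d. P a j * (- (g j / g D)))" if "a \<in> theta_idx d" for a
  proof -
    have "g D * P a D + (\<Sum>j\<in>theta_idx d. g j * P a j) = 0"
      using gradient_tangent[OF x that] D finite_theta_idx
      by (simp add: g_def P_def)
    then have "P a D = - (\<Sum>j\<in>theta_idx d. g j * P a j) / g D"
      using gD by (simp add: field_simps)
    then show ?thesis by (simp add: sum_divide_distrib sum_negf mult.commute)
  qed
  have "gram_det (theta_idx d) (tri_idx d) chart x =
      (\<Prod>a\<in>theta_idx d. P a a)\<^sup>2 * (1 + (\<Sum>j\<in>theta_idx d. (- (g j / g D))\<^sup>2))"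
    unfolding gram_det_def
  proof (rule leibniz_gram_rank_one[OF finite_theta_idx inj_on_lex_rank _ w])
    show "P a b = 0" if "a \<in> theta_idx d" "b \<in> theta_idx d" "lex_rank b < lex_rank a" for a b
      unfolding P_def using that by (rule partial_chart_eq_0)
    show "gram_entry (tri_idx d) chart x a b = (\<Sum>j\<in>theta_idx d. P a j * P b j) + P a D * P b D" for a b
      using D finite_theta_idx by (simp add: gram_entry_def P_def)
  qed
  also have "(\<Prod>a\<in>theta_idx d. P a a) = (\<Prod>(i, j)\<in>theta_idx d. x (i, i) / (c * chart x (i, i)))"
    by (rule prod.cong) (auto simp: P_def partial_chart_diag[OF x])
  finally show ?thesis by (simp add: g_def D_def)
qed

lemma diag_ratio_pos:
  assumes "x \<in> chart_dom" "(i, j) \<in> theta_idx d"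
  shows "x (i, i) / (c * chart x (i, i)) > 0"
proof -
  have "i < d - 1" using assms(2) by (simp add: theta_idx_iff)
  then show ?thesis
    using chart_dom_pos(1)[OF assms(1)] chart_diag_pos[OF assms(1)] c_pos
    by (intro divide_pos_pos mult_pos_pos) auto
qed

lemma local_param_chart: "local_param (theta_idx d) (tri_idx d) (M_tilde d \<gamma> c0) chart_dom chart"
  unfolding local_param_def
proof (intro conjI ballI)
  show "chart ` chart_dom \<subseteq> M_tilde d \<gamma> c0"
    using chart_M_star by (auto simp: M_star_def)
  fix a b assume ab: "a \<in> theta_idx d" "b \<in> tri_idx d"
  show "(\<lambda>s. chart (x(a := s)) b) differentiable at (x a)" if "x \<in> chart_dom" for x
    using C1_on_partial[OF C1_on_chart[OF ab(2)] ab(1) that] real_differentiable_def by blast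
  show "continuous_on chart_dom (partial a (\<lambda>y. chart y b))"
    by (rule C1_on_continuous_partial[OF C1_on_chart[OF ab(2)] ab(1)])
next
  fix x assume x: "x \<in> chart_dom"
  have "(\<Prod>(i, j)\<in>theta_idx d. x (i, i) / (c * chart x (i, i))) > 0"
    by (rule prod_pos) (auto dest!: diag_ratio_pos[OF x])
  moreover have "1 + (\<Sum>b\<in>theta_idx d. (partial b (g_map d \<gamma> c0) (chart x) /
      partial (d - 1, d - 1) (g_map d \<gamma> c0) (chart x))\<^sup>2) > 0"
    by (intro add_pos_nonneg sum_nonneg) auto
  ultimately show "gram_det (theta_idx d) (tri_idx d) chart x \<noteq> 0"
    unfolding gram_det_chart[OF x] by simp
qed (simp_all add: openin_chart_dom inj_on_chart continuous_on_chart)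

text \<open>Row \<open>i\<close> has \<open>d - i\<close> positions, whence the exponents. The
  factor \<open>1 / c\<close> occurs once per position, \<open>(d - 1) * (d + 2) / 2\<close> times
  in all, and \<open>c\<close> is the power \<open>- 1 / d\<close> of \<open>c0\<close>.\<close>

lemma J_tilde_chart:
  assumes x: "x \<in> chart_dom"
  shows "J_tilde d \<gamma> c0 (theta_mat d x) = (\<Prod>(i, j)\<in>theta_idx d. x (i, i) / (c * chart x (i, i)))"
proof -
  have K: "theta_idx d = (SIGMA i:{..<d - 1}. {i..<d})"
    by (auto simp: theta_idx_iff)
  have "2 * card (theta_idx d) = (d - 1) * (d + 2)"
  proof -
    obtain n where "d = Suc n" using d2 by (cases d) auto
    then show ?thesis by (simp add: card_theta_idx algebra_simps)
  qed
  then have "real ((d - 1) * (d + 2)) / real (2 * d) = real (card (theta_idx d)) / real d"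
    by (metis mult_divide_mult_cancel_left_if of_nat_mult of_nat_numeral zero_neq_numeral)
  then have powr: "c0 powr (real ((d - 1) * (d + 2)) / real (2 * d)) = 1 / c ^ card (theta_idx d)"
    using c0 by (simp add: c_def powr_power powr_minus_divide[symmetric])
  have "(\<Prod>(i, j)\<in>theta_idx d. x (i, i) / (c * chart x (i, i)))
      = (\<Prod>(i, j)\<in>theta_idx d. (1 / c) * (x (i, i) / chart x (i, i)))"
    by (rule prod.cong) auto
  also have "\<dots> = (1 / c) ^ card (theta_idx d) * (\<Prod>(i, j)\<in>theta_idx d. x (i, i) / chart x (i, i))"
    by (simp only: case_prod_unfold prod.distrib prod_constant)
  also have "(\<Prod>(i, j)\<in>theta_idx d. x (i, i) / chart x (i, i))
      = (\<Prod>i<d - 1. (x (i, i) / chart x (i, i)) ^ (d - i))"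
    unfolding K by (subst prod.Sigma[symmetric]) auto
  also have "\<dots> = (\<Prod>i<d - 1. (theta_mat d x $$ (i, i) / chart x (i, i)) ^ (d - i))"
    by (rule prod.cong) (auto simp: theta_mat_eq tri_mat_index tri_entry_def theta_ext_def)
  finally show ?thesis
    unfolding J_tilde_def H_of_theta_mat[OF x] powr by (simp add: power_divide)
qed

text \<open>The summand \<open>1\<close> is the \<open>D\<close> component of the gradient divided
  by itself, so the second factor of the Gram determinant is the squared norm of the whole gradient
  over \<open>(g D)\<^sup>2\<close>.\<close>

lemma sqrt_gram_det_chart:
  assumes x: "x \<in> chart_dom"
  shows "sqrt (gram_det (theta_idx d) (tri_idx d) chart x) =
    J_tilde d \<gamma> c0 (theta_mat d x) * Gamma_tilde d \<gamma> c0 (theta_mat d x)"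
proof -
  define g where "g b = partial b (g_map d \<gamma> c0) (chart x)" for b
  define D where "D = (d - 1, d - 1)"
  define A where "A = (\<Prod>(i, j)\<in>theta_idx d. x (i, i) / (c * chart x (i, i)))"
  have D: "D \<notin> theta_idx d" "tri_idx d = insert D (theta_idx d)"
    using tri_idx_eq by (auto simp: D_def theta_idx_iff)
  have gD: "g D > 0"
    unfolding g_def D_def using chart_diag_pos[OF x] d2 by (intro partial_g_map_last) simp
  have A: "A \<ge> 0" unfolding A_def
    by (rule prod_nonneg) (auto dest!: diag_ratio_pos[OF x])
  have "1 + (\<Sum>b\<in>theta_idx d. (g b / g D)\<^sup>2) = (\<Sum>b\<in>tri_idx d. (g b)\<^sup>2) / (g D)\<^sup>2"
    using gD D finite_theta_idx
    by (simp add: add_divide_distrib sum_divide_distrib power_divide)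
  moreover have "gram_det (theta_idx d) (tri_idx d) chart x =
      A\<^sup>2 * (1 + (\<Sum>b\<in>theta_idx d. (g b / g D)\<^sup>2))"
    unfolding gram_det_chart[OF x] A_def g_def D_def by (rule refl)
  ultimately have "sqrt (gram_det (theta_idx d) (tri_idx d) chart x) =
      A * (sqrt (\<Sum>b\<in>tri_idx d. (g b)\<^sup>2) / \<bar>g D\<bar>)"
    using A by (simp add: real_sqrt_mult real_sqrt_divide)
  then show ?thesis
    unfolding Gamma_tilde_def H_of_theta_mat[OF x] J_tilde_chart[OF x]
    by (simp add: A_def g_def D_def)
qed

end

section \<open>Lattice minima\<close>

lemma countable_carrier_vec: "countable (carrier_vec n :: 'a :: countable vec set)"
proof -
  have "a \<in> range (\<lambda>xs. vec n ((!) xs))" if "a \<in> carrier_vec n" for a :: "'a vec"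
  proof
    show "a = vec n ((!) (map (vec_index a) [0..<n]))" using that by auto
  qed simp
  then have "(carrier_vec n :: 'a vec set) \<subseteq> range (\<lambda>xs. vec n ((!) xs))" by blast
  then show ?thesis by (rule countable_subset) simp
qed

lemma finite_bounded_int_vec:
  "finite {a \<in> carrier_vec n. \<forall>j<n. \<bar>vec_index a j\<bar> \<le> (N :: int)}"
proof (rule finite_subset)
  show "{a \<in> carrier_vec n. \<forall>j<n. \<bar>vec_index a j\<bar> \<le> N} \<subseteq> vec n ` ({..<n} \<rightarrow>\<^sub>E {- N..N})"
  proof
    fix a assume a: "a \<in> {a \<in> carrier_vec n. \<forall>j<n. \<bar>vec_index a j\<bar> \<le> N}"
    then have "a = vec n (restrict (vec_index a) {..<n})" by auto
    moreover have "restrict (vec_index a) {..<n} \<in> {..<n} \<rightarrow>\<^sub>E {- N..N}"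
      using a by (auto simp: abs_le_iff)
    ultimately show "a \<in> vec n ` ({..<n} \<rightarrow>\<^sub>E {- N..N})" by blast
  qed
qed (intro finite_imageI finite_PiE, auto)

text \<open>The last index is wanted because \<open>L\<close> is upper triangular: coordinate
  \<open>i\<close> of \<open>L a\<close> then has a single nonzero term.\<close>

lemma exists_last_nonzero_index:
  assumes "a \<in> carrier_vec n - {0\<^sub>v n}"
  shows "\<exists>i<n. vec_index a i \<noteq> 0 \<and> (\<forall>j<n. i < j \<longrightarrow> vec_index a j = 0)"
proof -
  define I where "I = {i. i < n \<and> vec_index a i \<noteq> 0}"
  have "I \<noteq> {}"
  proof
    assume "I = {}"
    then have "a = 0\<^sub>v n" using assms by (intro eq_vecI) (auto simp: I_def)
    then show False using assms by simp
  qed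
  moreover have fin: "finite I" by (simp add: I_def)
  ultimately have m: "Max I \<in> I" by (rule Max_in[rotated])
  have "vec_index a j = 0" if "j < n" "Max I < j" for j
  proof (rule ccontr)
    assume "vec_index a j \<noteq> 0"
    then have "j \<in> I" using that(1) by (simp add: I_def)
    then show False using Max_ge[OF fin] that(2) by fastforce
  qed
  moreover have "Max I < n" "vec_index a (Max I) \<noteq> 0" using m unfolding I_def by blast+
  ultimately show ?thesis by blast
qed

section \<open>The lattice minimum as a condition on all integer vectors\<close>

context hypersurface begin

definition int_form :: "(nat \<times> nat \<Rightarrow> real) \<Rightarrow> int vec \<Rightarrow> real" where
  "int_form t a = (\<Sum>j<d. \<Sum>l<d. real_of_int (vec_index a j) * real_of_int (vec_index a l) * F_entry t j l)"

lemma int_form_eq: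
  assumes "a \<in> carrier_vec d"
  shows "scalar_prod (map_vec real_of_int a) (f_map d \<gamma> c0 t *\<^sub>v map_vec real_of_int a) = int_form t a"
proof -
  have "scalar_prod (map_vec real_of_int a) (f_map d \<gamma> c0 t *\<^sub>v map_vec real_of_int a)
      = (\<Sum>j<d. real_of_int (vec_index a j) * (\<Sum>l<d. F_entry t j l * real_of_int (vec_index a l)))"
    using assms f_map_carrier[of t]
    by (auto simp: scalar_prod_def atLeast0LessThan f_map_index intro!: sum.cong)
  then show ?thesis by (simp add: int_form_def sum_distrib_left mult_ac)
qed

text \<open>Integers satisfy \<open>\<bar>n\<bar> \<le> n\<^sup>2\<close>. The bound confines
  vectors with small form to a finite box.\<close>

lemma int_form_ge:
  assumes "j < d"
  shows "c * \<gamma> * \<bar>real_of_int (vec_index a j)\<bar> \<le> int_form t a"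
proof -
  have "\<bar>vec_index a j\<bar> \<le> (vec_index a j)\<^sup>2"
  proof (cases "vec_index a j = 0")
    case False
    then have "\<bar>vec_index a j\<bar> * 1 \<le> \<bar>vec_index a j\<bar> * \<bar>vec_index a j\<bar>"
      by (intro mult_left_mono) auto
    then show ?thesis by (simp add: power2_eq_square)
  qed simp
  then have "\<bar>real_of_int (vec_index a j)\<bar> \<le> (real_of_int (vec_index a j))\<^sup>2"
    by (metis of_int_abs of_int_le_iff of_int_power)
  also have "\<dots> \<le> (\<Sum>j<d. (real_of_int (vec_index a j))\<^sup>2)"
    by (rule member_le_sum) (use assms in auto)
  finally have "c * \<gamma> * \<bar>real_of_int (vec_index a j)\<bar> \<le> c * \<gamma> * (\<Sum>j<d. (real_of_int (vec_index a j))\<^sup>2)"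
    using c_pos gam by (intro mult_left_mono) auto
  moreover have "c * (\<Sum>k<d. (\<Sum>j<d. tri_entry t k j * real_of_int (vec_index a j))\<^sup>2) \<ge> 0"
    using c_pos by (intro mult_nonneg_nonneg sum_nonneg) auto
  ultimately show ?thesis unfolding int_form_def F_entry_form by linarith
qed

text \<open>A \<open>LEAST\<close> over the reals has the intended value only if the minimum is
  attained. It is: only finitely many integer vectors have a form at most that of a fixed
  \<open>a0\<close>.\<close>

lemma lattice_min_greater_iff:
  "\<delta> < lattice_min d (f_map d \<gamma> c0 t) \<longleftrightarrow> (\<forall>a\<in>carrier_vec d - {0\<^sub>v d}. \<delta> < int_form t a)"
proof -
  define S where "S = (carrier_vec d - {0\<^sub>v d} :: int vec set)"
  have "unit_vec d 0 \<in> S" using d2 by (simp add: S_def)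
  then obtain a0 where a0: "a0 \<in> S" by blast
  define A where "A = {a \<in> S. int_form t a \<le> int_form t a0}"
  have "finite A"
  proof (rule finite_subset)
    show "A \<subseteq> {a \<in> carrier_vec d. \<forall>j<d. \<bar>vec_index a j\<bar> \<le> \<lfloor>int_form t a0 / (c * \<gamma>)\<rfloor>}"
    proof clarify
      fix a assume a: "a \<in> A"
      have "\<bar>vec_index a j\<bar> \<le> \<lfloor>int_form t a0 / (c * \<gamma>)\<rfloor>" if "j < d" for j
      proof -
        have "\<bar>real_of_int (vec_index a j)\<bar> * (c * \<gamma>) \<le> int_form t a0"
          using int_form_ge[OF that, of a t] a by (simp add: A_def mult.commute)
        then have "\<bar>real_of_int (vec_index a j)\<bar> \<le> int_form t a0 / (c * \<gamma>)"
          using c_pos gam by (simp add: pos_le_divide_eq)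
        then show ?thesis by (simp add: le_floor_iff)
      qed
      then show "a \<in> carrier_vec d \<and> (\<forall>j<d. \<bar>vec_index a j\<bar> \<le> \<lfloor>int_form t a0 / (c * \<gamma>)\<rfloor>)"
        using a by (simp add: A_def S_def)
    qed
  qed (rule finite_bounded_int_vec)
  moreover have "a0 \<in> A" using a0 by (simp add: A_def)
  ultimately obtain b where b: "b \<in> A" "\<And>a. a \<in> A \<Longrightarrow> int_form t b \<le> int_form t a"
    by (metis arg_min_if_finite(1) arg_min_least empty_iff)
  have min: "int_form t b \<le> int_form t a" if "a \<in> S" for a
    using that b(2)[of a] b(2)[OF \<open>a0 \<in> A\<close>] by (cases "a \<in> A") (auto simp: A_def)
  have "lattice_min d (f_map d \<gamma> c0 t) = (LEAST m. \<exists>a\<in>S. m = int_form t a)"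
    unfolding lattice_min_def S_def
    by (rule arg_cong[where f = Least], rule ext, rule bex_cong) (auto simp: int_form_eq)
  also have "\<dots> = int_form t b"
    by (rule Least_equality) (use b min in \<open>auto simp: A_def\<close>)
  finally show ?thesis
    using min b(1) unfolding S_def[symmetric] by (auto simp: A_def intro: less_le_trans)
qed

section \<open>Measurability of the sets involved\<close>

lemma N_star_delta_eq:
  "N_star_delta d \<gamma> c0 \<delta> =
    {x \<in> chart_dom. (\<forall>i<d - 1. x (i, i) > sqrt \<delta>) \<and> (\<Prod>i<d - 1. x (i, i)) < 1 / sqrt \<delta>}"
proof -
  have "beta_part d x \<in> Delta (d - 1) \<delta> \<longleftrightarrow>
      (\<forall>i<d - 1. x (i, i) > sqrt \<delta>) \<and> (\<Prod>i<d - 1. x (i, i)) < 1 / sqrt \<delta>" if "x \<in> chart_dom" for x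
    using chart_dom_pos(1)[OF that] by (auto simp: beta_part_def Delta_def)
  moreover have "x \<in> theta_idx d \<rightarrow>\<^sub>E UNIV" if "x \<in> chart_dom" for x
    using that by (simp add: chart_dom_def)
  ultimately show ?thesis
    unfolding N_star_delta_def by (auto simp: theta_mat_N_star_iff)
qed

lemma space_leb: "space (leb K) = K \<rightarrow>\<^sub>E UNIV"
  by (simp add: leb_def space_PiM)

lemma measurable_coord_leb [measurable (raw)]:
  "j \<in> K \<Longrightarrow> (\<lambda>t. t j) \<in> borel_measurable (leb K)"
  unfolding leb_def using measurable_component_singleton[of j K "\<lambda>_. lborel :: real measure"] by simp

lemma N_star_delta_sets: "N_star_delta d \<gamma> c0 \<delta> \<in> sets (leb (theta_idx d))"
proof -
  have i: "(i, i) \<in> theta_idx d" if "i < d - 1" for i using that by (simp add: theta_idx_iff)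
  have "{x \<in> space (leb (theta_idx d)). \<forall>i\<in>{..<d - 1}. x (i, i) > sqrt \<delta>} \<in> sets (leb (theta_idx d))"
    by (rule sets.sets_Collect_countable_All')
      (auto intro!: borel_measurable_less measurable_coord_leb simp: i)
  moreover have "(\<lambda>x. \<Prod>i<d - 1. x (i, i)) \<in> borel_measurable (leb (theta_idx d))"
    by (rule borel_measurable_prod) (auto intro!: measurable_coord_leb simp: i)
  then have "{x \<in> space (leb (theta_idx d)). (\<Prod>i<d - 1. x (i, i)) < 1 / sqrt \<delta>} \<in> sets (leb (theta_idx d))"
    by measurable
  moreover have "chart_dom \<in> sets (leb (theta_idx d))"
    by (rule openin_sets_leb[OF openin_chart_dom])
  moreover have "N_star_delta d \<gamma> c0 \<delta> = chart_dom \<inter>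
      {x \<in> space (leb (theta_idx d)). \<forall>i\<in>{..<d - 1}. x (i, i) > sqrt \<delta>} \<inter>
      {x \<in> space (leb (theta_idx d)). (\<Prod>i<d - 1. x (i, i)) < 1 / sqrt \<delta>}"
    unfolding N_star_delta_eq space_leb by (auto simp: chart_dom_def)
  ultimately show ?thesis by (simp only: sets.Int)
qed

definition good_set :: "real \<Rightarrow> (nat \<times> nat \<Rightarrow> real) set" where
  "good_set \<delta> = {H \<in> M_star d \<gamma> c0. lattice_min d (f_map d \<gamma> c0 H) > \<delta>}"

text \<open>Rank and \<open>LEAST\<close> are replaced by positivity of the diagonal and by one
  strict inequality for each of countably many integer vectors.\<close>

lemma good_set_sets: "good_set \<delta> \<in> sets (restrict_space (leb (tri_idx d)) (M_tilde d \<gamma> c0))"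
proof -
  let ?L = "leb (tri_idx d)"
  define C where "C = {t \<in> space ?L. (\<forall>i\<in>{..<d}. t (i, i) > 0)} \<inter>
      {t \<in> space ?L. \<forall>a\<in>carrier_vec d - {0\<^sub>v d}. \<delta> < int_form t a}"
  have tri: "(\<lambda>t. tri_entry t k j) \<in> borel_measurable ?L" if "j < d" for k j
    by (cases "k \<le> j") (use that in \<open>auto simp: tri_entry_def tri_idx_def intro!: measurable_coord_leb\<close>)
  have F: "(\<lambda>t. F_entry t j l) \<in> borel_measurable ?L" if "j < d" "l < d" for j l
    unfolding F_entry_def
    by (intro borel_measurable_times borel_measurable_add borel_measurable_sum
        borel_measurable_const tri that)
  have form: "(\<lambda>t. int_form t a) \<in> borel_measurable ?L" for a
    unfolding int_form_def
    by (intro borel_measurable_sum borel_measurable_times borel_measurable_const F) auto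
  have "{t \<in> space ?L. \<delta> < int_form t a} \<in> sets ?L" for a
    using form[of a] by measurable
  then have "{t \<in> space ?L. \<forall>a\<in>carrier_vec d - {0\<^sub>v d}. \<delta> < int_form t a} \<in> sets ?L"
    by (intro sets.sets_Collect_countable_All' countable_Diff countable_carrier_vec)
  moreover have "{t \<in> space ?L. \<forall>i\<in>{..<d}. t (i, i) > 0} \<in> sets ?L"
    by (rule sets.sets_Collect_countable_All')
      (auto intro!: borel_measurable_less measurable_coord_leb simp: tri_idx_def)
  ultimately have "C \<in> sets ?L" unfolding C_def by (intro sets.Int)
  moreover have "good_set \<delta> = M_tilde d \<gamma> c0 \<inter> C"
    unfolding good_set_def C_def lattice_min_greater_iff space_leb
    by (auto simp: M_star_iff M_tilde_def tri_nonneg_def)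
  ultimately show ?thesis by (auto simp: sets_restrict_space)
qed

section \<open>From the chart to the lower bound\<close>

lemma chart_in_good_set:
  assumes \<delta>: "\<delta> > 0" and x: "x \<in> N_star_delta d \<gamma> c0 \<delta>"
  shows "chart x \<in> good_set \<delta>"
proof -
  define L where "L = theta_ext d x"
  have x': "x \<in> chart_dom" "\<And>i. i < d - 1 \<Longrightarrow> x (i, i) > sqrt \<delta>" "(\<Prod>i<d - 1. x (i, i)) < 1 / sqrt \<delta>"
    using x by (auto simp: N_star_delta_eq)
  have L: "L (i, i) > sqrt \<delta>" if "i < d" for i
  proof (cases "i = d - 1")
    case True
    \<comment> \<open>The last diagonal entry is the reciprocal of this product, so the upper bound
      in \<open>Delta\<close> is what keeps it above \<open>sqrt \<delta>\<close>.\<close>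
    have "(\<Prod>i<d - 1. x (i, i)) > 0" using chart_dom_pos(1)[OF x'(1)] by (intro prod_pos) simp
    then have "sqrt \<delta> < 1 / (\<Prod>i<d - 1. x (i, i))"
      using x'(3) \<delta> by (simp add: pos_less_divide_eq mult.commute)
    then show ?thesis using True by (simp add: L_def theta_ext_def)
  qed (use that x'(2) in \<open>simp add: L_def theta_ext_def\<close>)
  have "\<delta> < int_form (chart x) a" if a: "a \<in> carrier_vec d - {0\<^sub>v d}" for a
  proof -
    obtain i where i: "i < d" "vec_index a i \<noteq> 0" "\<And>j. j < d \<Longrightarrow> i < j \<Longrightarrow> vec_index a j = 0"
      using exists_last_nonzero_index[OF a] by blast
    define r where "r k = (\<Sum>j<d. tri_entry L k j * real_of_int (vec_index a j))" for k
    have F: "F_entry (chart x) j l = (\<Sum>k<d. tri_entry L k j * tri_entry L k l)"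
      if "j < d" "l < d" for j l
    proof -
      have "F_entry (chart x) j l = c * (Q_entry x j l + (if j = l then \<gamma> else 0))"
        using that f_map_index[of j l "chart x"] chol_theta_mat_index[of j l x]
        by (simp add: f_map_chart[OF x'(1)])
      then show ?thesis using c_pos by (simp add: Q_entry_def L_def)
    qed
    have "int_form (chart x) a = (\<Sum>j<d. \<Sum>l<d. real_of_int (vec_index a j) * real_of_int (vec_index a l) *
        (\<Sum>k<d. tri_entry L k j * tri_entry L k l))"
      unfolding int_form_def by (intro sum.cong refl) (simp add: F)
    also have "\<dots> = (\<Sum>k<d. (r k)\<^sup>2)" unfolding gram_form r_def ..
    finally have form: "int_form (chart x) a = (\<Sum>k<d. (r k)\<^sup>2)" .
    \<comment> \<open>Left of column \<open>i\<close> the entries of row \<open>i\<close> vanish,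
      and right of it those of \<open>a\<close> do.\<close>
    have "r i = (\<Sum>j<d. if j = i then L (i, i) * real_of_int (vec_index a i) else 0)"
      unfolding r_def by (rule sum.cong) (use i in \<open>auto simp: tri_entry_def not_less_iff_gr_or_eq\<close>)
    then have "r i = L (i, i) * real_of_int (vec_index a i)" using i(1) by simp
    moreover have "1 \<le> (real_of_int (vec_index a i))\<^sup>2"
    proof -
      have "1 \<le> \<bar>vec_index a i\<bar>" using i(2) by linarith
      then have "1 \<le> (vec_index a i)\<^sup>2" by (metis one_le_power power2_abs)
      then show ?thesis by (metis of_int_1_le_iff of_int_power)
    qed
    ultimately have "(L (i, i))\<^sup>2 \<le> (r i)\<^sup>2"
      by (simp add: power_mult_distrib mult_le_cancel_left1)
    moreover have "\<delta> < (L (i, i))\<^sup>2"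
      using power_strict_mono[OF L[OF i(1)], of 2] \<delta> by simp
    moreover have "(r i)\<^sup>2 \<le> (\<Sum>k<d. (r k)\<^sup>2)"
      by (rule member_le_sum) (use i in auto)
    ultimately show ?thesis unfolding form by linarith
  qed
  then show ?thesis
    unfolding good_set_def using chart_M_star[OF x'(1)] by (simp add: lattice_min_greater_iff)
qed

lemma volume_ge:
  assumes "\<delta> > 0"
  shows "(\<integral>\<^sup>+x\<in>N_star_delta d \<gamma> c0 \<delta>.
       ennreal (J_tilde d \<gamma> c0 (theta_mat d x) * Gamma_tilde d \<gamma> c0 (theta_mat d x))
     \<partial>leb (theta_idx d)) \<le> emeasure (vol_M d \<gamma> c0) (good_set \<delta>)"
proof -
  let ?K = "theta_idx d" and ?J = "tri_idx d" and ?N = "N_star_delta d \<gamma> c0 \<delta>"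
  have N: "?N \<subseteq> chart_dom" by (auto simp: N_star_delta_eq)
  \<comment> \<open>A piece family is indexed by all natural numbers; it is padded with the empty
    parametrization, which satisfies \<open>local_param\<close> vacuously.\<close>
  define P where "P n = (if n = 0 then (chart_dom, chart, ?N) else ({}, \<lambda>_. undefined, {}))" for n :: nat
  have "P \<in> pieces ?K ?J (M_tilde d \<gamma> c0) (good_set \<delta>)"
    unfolding pieces_def P_def
    using local_param_chart N_star_delta_sets N chart_in_good_set[OF assms]
    by (auto simp: local_param_def[of _ _ _ "{}"] disjoint_family_on_def)
  then have le: "(\<Sum>n. piece_volume ?K ?J (P n)) \<le> emeasure (vol_M d \<gamma> c0) (good_set \<delta>)"
    unfolding emeasure_vol_M[OF good_set_sets] volume_fun_def by (rule SUP_upper)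
  have "ennreal (J_tilde d \<gamma> c0 (theta_mat d x) * Gamma_tilde d \<gamma> c0 (theta_mat d x)) * indicator ?N x =
      ennreal (sqrt (gram_det ?K ?J chart x)) * indicator ?N x" for x
  proof (cases "x \<in> ?N")
    case True
    then have "x \<in> chart_dom" using N by blast
    then show ?thesis by (simp only: sqrt_gram_det_chart)
  qed simp
  then have "(\<integral>\<^sup>+x\<in>?N. ennreal (J_tilde d \<gamma> c0 (theta_mat d x) * Gamma_tilde d \<gamma> c0 (theta_mat d x))
      \<partial>leb ?K) = piece_volume ?K ?J (P 0)"
    by (simp add: P_def piece_volume_def)
  also have "\<dots> \<le> (\<Sum>n. piece_volume ?K ?J (P n))"
    using sum_le_suminf[of "\<lambda>n. piece_volume ?K ?J (P n)" "{0}"] by simp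
  finally show ?thesis using le by (rule order_trans)
qed

end

theorem theorem5:
  fixes d :: nat and \<gamma> c0 \<delta> :: real
  assumes "d \<ge> 2" and "\<gamma> > 0" and "c0 > 0" and "c0 > \<gamma> ^ d"
    and "\<gamma> * c0 powr (- 1 / real d) < \<delta>" and "\<delta> < 1"
  shows "m_frak d \<gamma> c0 \<delta> \<ge> inverse (kappa d \<gamma> c0) *
    (\<integral>\<^sup>+x\<in>N_star_delta d \<gamma> c0 \<delta>.
       ennreal (J_tilde d \<gamma> c0 (theta_mat d x) * Gamma_tilde d \<gamma> c0 (theta_mat d x))
     \<partial>leb (theta_idx d))"
proof -
  interpret hypersurface d \<gamma> c0
    using assms(1-3) by unfold_locales
  have "\<gamma> * c0 powr (- 1 / real d) > 0" using assms(2,3) by simp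
  then have "\<delta> > 0" using assms(5) by linarith
  have sets: "good_set \<delta> \<in> sets (vol_M d \<gamma> c0)" "M_tilde d \<gamma> c0 \<in> sets (vol_M d \<gamma> c0)"
  proof -
    have "space (vol_M d \<gamma> c0) = M_tilde d \<gamma> c0"
      by (auto simp: vol_M_def space_induced_volume M_tilde_def tri_nonneg_def)
    then show "M_tilde d \<gamma> c0 \<in> sets (vol_M d \<gamma> c0)" by (metis sets.top)
    show "good_set \<delta> \<in> sets (vol_M d \<gamma> c0)"
      using good_set_sets by (simp add: vol_M_def sets_induced_volume)
  qed
  have "good_set \<delta> \<subseteq> M_tilde d \<gamma> c0" by (auto simp: good_set_def M_star_def)
  \<comment> \<open>The uniform measure is a quotient of volumes. In \<open>ennreal\<close>,
    division is multiplication by the inverse, so no case distinction on the area arises.\<close>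
  then have "m_frak d \<gamma> c0 \<delta> =
      emeasure (vol_M d \<gamma> c0) (good_set \<delta>) / emeasure (vol_M d \<gamma> c0) (M_tilde d \<gamma> c0)"
    unfolding m_frak_def nu_tilde_def good_set_def[symmetric]
    using sets by (simp add: Int_absorb1)
  also have "\<dots> = inverse (kappa d \<gamma> c0) * emeasure (vol_M d \<gamma> c0) (good_set \<delta>)"
    using sets by (simp add: kappa_def divide_ennreal_def mult.commute)
  finally show ?thesis
    using volume_ge[OF \<open>\<delta> > 0\<close>] by (simp add: mult_left_mono)
qed

end
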